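(* Consider the ring-road closed-loop system described in the context and suppose that $R<n\lambda$. Then there exist functions $\sigma\in KL$ and $a\in K_\infty$ such that every solution $(s(t),v(t))\in\Omega$ of the closed-loop system is defined for all $t\ge 0$ and satisfies for all $t\ge 0$ $$a\left(\left|\left(s(t)-n^{-1}R\,1_{n-1},\,v(t)-v^*1_n\right)\right|\right)\le U(s(t),v(t))\le\sigma\big(U(s(0),v(0)),t\big).$$ Moreover, there exist a size function $\kappa:\Omega\to\mathbb{R}_+$ with $\kappa(n^{-1}R\,1_{n-1},v^*1_n)=0$ and a constant $\bar\omega>0$ such that every solution $(s(t),v(t))\in\Omega$ of the closed-loop system satisfies $$\left|\left(s(t)-n^{-1}R\,1_{n-1},\,v(t)-v^*1_n\right)\right|\le\exp(-\bar\omega t)\,\kappa(s(0),v(0))\quad\text{for all } t\ge 0.$$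
   Context: Notation: $\mathbb{R}_+=[0,+\infty)$; $|\cdot|$ is the Euclidean norm; $1_m=(1,\dots,1)\in\mathbb{R}^m$. Class $K$: increasing continuous $a:\mathbb{R}_+\to\mathbb{R}_+$ with $a(0)=0$; class $K_\infty$: those $a\in K$ with $\lim_{s\to+\infty}a(s)=+\infty$; class $KL$: continuous $\sigma:\mathbb{R}_+\times\mathbb{R}_+\to\mathbb{R}_+$ with $\sigma(\cdot,t)\in K$ for each $t\ge0$ and $\sigma(s,\cdot)$ non-increasing with $\lim_{t\to+\infty}\sigma(s,t)=0$ for each $s\ge 0$. A size function on $\Omega$ (for the closed-loop system) is a continuous $\varphi:\Omega\to\mathbb{R}_+$ such that for every $r>\inf(\varphi(\Omega))$ the set $\{x\in\Omega:\varphi(x)\le r\}$ is compact. Constants: integer $n\ge 2$; $R>0$; $L\in(0,n^{-1}R)$; $\lambda>L$; $v_{\max}>0$; $v^*\in(0,v_{\max})$; $\mu>0$. Functions: $V\in C^3((L,+\infty);\mathbb{R}_+)$ satisfies $\lim_{x\to L^+}V(x)=+\infty$, $V(x)=0$ for $x\ge\lambda$, and $V'(x)<0$, $V''(x)>0$ for $x\in(L,\lambda)$. $b:\mathbb{R}\to(v^*-v_{\max},v^* )$ is $C^2$ and increasing, with $b(0)=0$, $xb(x)>0$ for $x\ne 0$, and $b'(0)>0$. State: $s=(s_2,\dots,s_n)\in\mathbb{R}^{n-1}$, $v=(v_1,\dots,v_n)\in\mathbb{R}^n$, with conventions $s_1=s_{n+1}=R-\sum_{i=2}^n s_i$, $v_0=v_n$,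 $v_{n+1}=v_1$. State space (open set): $$\Omega=\Big\{(s,v)\in\mathbb{R}^{2n-1}:\ \min_{i=2,\dots,n}s_i>L,\ L+\sum_{i=2}^n s_i<R,\ \max_{i=1,\dots,n}v_i<v_{\max},\ \min_{i=1,\dots,n}v_i>0\Big\}.$$ Define, for $i=1,\dots,n$, $$f_i(s)=v^*-b\big(V'(s_{i+1})-V'(s_i)\big),$$ $$Z_i(s,v)=-v_{\max}^2\,b'\big(V'(s_{i+1})-V'(s_i)\big)\big(V''(s_{i+1})(v_i-v_{i+1})-V''(s_i)(v_{i-1}-v_i)\big),$$ and for $w,y\in(0,v_{\max})$ $$\beta(w,y)=\frac{v_{\max}^3(w+y)-2v_{\max}^2yw}{2(v_{\max}-w)^2w^2}\ (>0).$$ The ring-road closed-loop system on $\Omega$ is $$\dot{s}_i=v_{i-1}-v_i,\ i=2,\dots,n,\qquad \dot{v}_i=F_i,\ i=1,\dots,n,$$ $$F_i=\frac{1}{\beta(v_i,f_i(s))}\left(\frac{Z_i(s,v)-\mu v_{\max}^2(v_i-f_i(s))}{v_i(v_{\max}-v_i)}+V'(s_i)-V'(s_{i+1})\right).$$ Define on $\Omega$ $$H(s,v)=\frac{v_{\max}^2}{2}\sum_{i=1}^n\frac{(v_i-f_i(s))^2}{v_i(v_{\max}-v_i)}+\sum_{i=1}^nV(s_i),\qquad U(s,v)=H(s,v)-nV(n^{-1}R).$$ *)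

theory Defs
  imports "HOL-Analysis.Analysis"
begin

definition class_K :: "(real \<Rightarrow> real) \<Rightarrow> bool" where
  "class_K a \<longleftrightarrow>
     a \<in> {0..} \<rightarrow> {0..} \<and> continuous_on {0..} a \<and> strict_mono_on {0..} a \<and> a 0 = 0"

definition class_K_inf :: "(real \<Rightarrow> real) \<Rightarrow> bool" where
  "class_K_inf a \<longleftrightarrow> class_K a \<and> filterlim a at_top at_top"

definition class_KL :: "(real \<Rightarrow> real \<Rightarrow> real) \<Rightarrow> bool" where
  "class_KL \<sigma> \<longleftrightarrow>
     continuous_on ({0..} \<times> {0..}) (\<lambda>(s, t). \<sigma> s t) \<and>
     (\<forall>t\<ge>0. class_K (\<lambda>s. \<sigma> s t)) \<and>
     (\<forall>s\<ge>0. antimono_on {0..} (\<sigma> s) \<and> (\<sigma> s \<longlongrightarrow> 0) at_top)"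

text \<open>\<^term>\<open>k\<close> times continuously differentiable on a set \<^term>\<open>S\<close>, which is meant to be open,
  so that the iterated \<^const>\<open>deriv\<close> depends only on the values of the function on \<^term>\<open>S\<close>.\<close>

definition C_diff_on :: "nat \<Rightarrow> (real \<Rightarrow> real) \<Rightarrow> real set \<Rightarrow> bool" where
  "C_diff_on k f S \<longleftrightarrow>
     (\<forall>j<k. \<forall>x\<in>S. ((deriv ^^ j) f) field_differentiable (at x)) \<and>
     continuous_on S ((deriv ^^ k) f)"

definition size_function :: "'a::topological_space set \<Rightarrow> ('a \<Rightarrow> real) \<Rightarrow> bool" where
  "size_function \<Omega> \<phi> \<longleftrightarrow>
     continuous_on \<Omega> \<phi> \<and> \<phi> \<in> \<Omega> \<rightarrow> {0..} \<and>
     (\<forall>r. r > Inf (\<phi> ` \<Omega>) \<longrightarrow> compact {x \<in> \<Omega>. \<phi> x \<le> r})"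

text \<open>A vector indexed by a finite set \<open>I\<close> of natural numbers is a function on \<^typ>\<open>nat\<close> that
  vanishes off \<open>I\<close>; here \<open>I\<close> is \<open>{2..n}\<close> for the spacings and \<open>{1..n}\<close> for the speeds. On such
  functions the product topology of \<^typ>\<open>nat \<Rightarrow> real\<close> is the Euclidean topology, so
  \<^const>\<open>continuous_on\<close> and \<^const>\<open>compact\<close> have their usual meaning (cf. \<open>Euclidean_space\<close>
  in \<open>HOL-Analysis\<close>).\<close>

type_synonym state = "(nat \<Rightarrow> real) \<times> (nat \<Rightarrow> real)"

definition gap :: "nat \<Rightarrow> real \<Rightarrow> (nat \<Rightarrow> real) \<Rightarrow> nat \<Rightarrow> real" where
  "gap n R s i = (if i \<in> {2..n} then s i else R - (\<Sum>j=2..n. s j))"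

definition speed :: "nat \<Rightarrow> (nat \<Rightarrow> real) \<Rightarrow> nat \<Rightarrow> real" where
  "speed n v i = (if i = 0 then v n else if i = n + 1 then v 1 else v i)"

definition Omega :: "nat \<Rightarrow> real \<Rightarrow> real \<Rightarrow> real \<Rightarrow> state set" where
  "Omega n R L vmax =
     {(s, v). (\<forall>i. i \<notin> {2..n} \<longrightarrow> s i = 0) \<and> (\<forall>i. i \<notin> {1..n} \<longrightarrow> v i = 0) \<and>
        (\<forall>i\<in>{2..n}. L < s i) \<and> L + (\<Sum>i=2..n. s i) < R \<and>
        (\<forall>i\<in>{1..n}. v i < vmax) \<and> (\<forall>i\<in>{1..n}. 0 < v i)}"

definition equilibrium :: "nat \<Rightarrow> real \<Rightarrow> real \<Rightarrow> state" where
  "equilibrium n R vstar =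
     ((\<lambda>i. if i \<in> {2..n} then R / real n else 0), (\<lambda>i. if i \<in> {1..n} then vstar else 0))"

definition state_dist :: "nat \<Rightarrow> state \<Rightarrow> state \<Rightarrow> real" where
  "state_dist n x y =
     sqrt ((\<Sum>i=2..n. (fst x i - fst y i)\<^sup>2) + (\<Sum>i=1..n. (snd x i - snd y i)\<^sup>2))"

definition f_ring ::
  "nat \<Rightarrow> real \<Rightarrow> real \<Rightarrow> (real \<Rightarrow> real) \<Rightarrow> (real \<Rightarrow> real) \<Rightarrow> nat \<Rightarrow> (nat \<Rightarrow> real) \<Rightarrow> real" where
  "f_ring n R vstar V b i s =
     vstar - b (deriv V (gap n R s (i + 1)) - deriv V (gap n R s i))"

definition Z_ring ::
  "nat \<Rightarrow> real \<Rightarrow> real \<Rightarrow> (real \<Rightarrow> real) \<Rightarrow> (real \<Rightarrow> real) \<Rightarrow> nat \<Rightarrow> state \<Rightarrow> real" where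
  "Z_ring n R vmax V b i = (\<lambda>(s, v).
     - (vmax\<^sup>2) * deriv b (deriv V (gap n R s (i + 1)) - deriv V (gap n R s i)) *
       (deriv (deriv V) (gap n R s (i + 1)) * (speed n v i - speed n v (i + 1)) -
        deriv (deriv V) (gap n R s i) * (speed n v (i - 1) - speed n v i)))"

definition beta :: "real \<Rightarrow> real \<Rightarrow> real \<Rightarrow> real" where
  "beta vmax w y =
     (vmax ^ 3 * (w + y) - 2 * vmax\<^sup>2 * y * w) / (2 * (vmax - w)\<^sup>2 * w\<^sup>2)"

definition F_ring ::
  "nat \<Rightarrow> real \<Rightarrow> real \<Rightarrow> real \<Rightarrow> real \<Rightarrow> (real \<Rightarrow> real) \<Rightarrow> (real \<Rightarrow> real) \<Rightarrow> nat \<Rightarrow> state \<Rightarrow> real" where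
  "F_ring n R vmax vstar \<mu> V b i = (\<lambda>(s, v).
     1 / beta vmax (v i) (f_ring n R vstar V b i s) *
     ((Z_ring n R vmax V b i (s, v) - \<mu> * vmax\<^sup>2 * (v i - f_ring n R vstar V b i s)) /
        (v i * (vmax - v i)) +
      deriv V (gap n R s i) - deriv V (gap n R s (i + 1))))"

definition H_ring ::
  "nat \<Rightarrow> real \<Rightarrow> real \<Rightarrow> real \<Rightarrow> (real \<Rightarrow> real) \<Rightarrow> (real \<Rightarrow> real) \<Rightarrow> state \<Rightarrow> real" where
  "H_ring n R vmax vstar V b = (\<lambda>(s, v).
     vmax\<^sup>2 / 2 * (\<Sum>i=1..n. (v i - f_ring n R vstar V b i s)\<^sup>2 / (v i * (vmax - v i))) +
     (\<Sum>i=1..n. V (gap n R s i)))"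

definition U_ring ::
  "nat \<Rightarrow> real \<Rightarrow> real \<Rightarrow> real \<Rightarrow> (real \<Rightarrow> real) \<Rightarrow> (real \<Rightarrow> real) \<Rightarrow> state \<Rightarrow> real" where
  "U_ring n R vmax vstar V b x = H_ring n R vmax vstar V b x - real n * V (R / real n)"

text \<open>A solution in \<open>\<Omega>\<close> on a time interval \<^term>\<open>J\<close> that starts at time \<open>0\<close>. The degenerate interval
  \<open>{0}\<close> is allowed: every point of \<open>\<Omega>\<close> is then the initial value of some solution, so a
  claim about all maximal solutions also asserts that solutions exist for all initial values.\<close>

definition ring_solution ::
  "nat \<Rightarrow> real \<Rightarrow> real \<Rightarrow> real \<Rightarrow> real \<Rightarrow> real \<Rightarrow> (real \<Rightarrow> real) \<Rightarrow> (real \<Rightarrow> real) \<Rightarrow>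
     real set \<Rightarrow> (real \<Rightarrow> state) \<Rightarrow> bool" where
  "ring_solution n R L vmax vstar \<mu> V b J x \<longleftrightarrow>
     is_interval J \<and> 0 \<in> J \<and> J \<subseteq> {0..} \<and>
     (\<forall>t\<in>J. x t \<in> Omega n R L vmax \<and>
        (\<forall>i\<in>{2..n}. ((\<lambda>\<tau>. fst (x \<tau>) i) has_real_derivative
           speed n (snd (x t)) (i - 1) - speed n (snd (x t)) i) (at t within J)) \<and>
        (\<forall>i\<in>{1..n}. ((\<lambda>\<tau>. snd (x \<tau>) i) has_real_derivative
           F_ring n R vmax vstar \<mu> V b i (x t)) (at t within J)))"

definition maximal_ring_solution ::
  "nat \<Rightarrow> real \<Rightarrow> real \<Rightarrow> real \<Rightarrow> real \<Rightarrow> real \<Rightarrow> (real \<Rightarrow> real) \<Rightarrow> (real \<Rightarrow> real) \<Rightarrow>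
     real set \<Rightarrow> (real \<Rightarrow> state) \<Rightarrow> bool" where
  "maximal_ring_solution n R L vmax vstar \<mu> V b J x \<longleftrightarrow>
     ring_solution n R L vmax vstar \<mu> V b J x \<and>
     (\<forall>J' x'. ring_solution n R L vmax vstar \<mu> V b J' x' \<and> J \<subseteq> J' \<and> (\<forall>t\<in>J. x' t = x t) \<longrightarrow> J' = J)"

end

theory Submission
  imports Defs
begin

text \<open>Write \<open>e\<^sub>i = v\<^sub>i - f\<^sub>i(s)\<close> for the speed errors and \<open>g\<^sub>i = V'(s\<^sub>i\<^sub>+\<^sub>1) - V'(s\<^sub>i)\<close>. The feedback is
designed so that \<open>Z\<^sub>i = vmax\<^sup>2 df\<^sub>i/dt\<close> and the weight \<open>\<beta>\<close> is the one that appears when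
\<open>e\<^sub>i\<^sup>2 / (v\<^sub>i (vmax - v\<^sub>i))\<close> is differentiated. Everything except two negative terms then cancels
(cyclic summation by parts, and \<open>\<Sum> g\<^sub>i = 0\<close>), which leaves \<open>dU/dt = - D\<close> with
\<open>D = \<mu> vmax\<^sup>2 \<Sum> e\<^sub>i\<^sup>2 / (v\<^sub>i (vmax - v\<^sub>i)) + \<Sum> g\<^sub>i b(g\<^sub>i)\<close> (\<open>U_derivative\<close>).

Three static estimates carry the theorem. First, \<open>U\<close> dominates a multiple of the squared distance
to the equilibrium on all of \<open>\<Omega>\<close> (\<open>U_quadratic_lower\<close>): since \<open>R < n \<lambda>\<close>, the mean spacing \<open>R/n\<close>
lies where \<open>V'' > 0\<close>, so the convex function \<open>V\<close> grows quadratically away from its tangent at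
\<open>R/n\<close>, and the tangent terms add up to zero because the spacings add up to \<open>R\<close>. Secondly, the
sublevel sets of \<open>U\<close> are compact (\<open>compact_sublevel\<close>): \<open>V\<close> blows up at \<open>L\<close>, which bounds the
spacings away from \<open>L\<close>, hence bounds the \<open>g\<^sub>i\<close>, hence keeps the \<open>f\<^sub>i\<close> in a compact part of
\<open>(0, vmax)\<close>, and then the weights \<open>1 / (v\<^sub>i (vmax - v\<^sub>i))\<close> do the same for the speeds. Thirdly,
\<open>D \<ge> w U\<close> on the set \<open>U \<le> r\<close> with some \<open>w > 0\<close> that depends on \<open>r\<close> (\<open>dissipation_rate\<close>). The
kinetic parts of \<open>U\<close> and \<open>D\<close> are proportional. For the potential parts, one spacing lies below and
one above \<open>R/n\<close>, so every \<open>|V'(s\<^sub>i) - V'(R/n)|\<close> is at most \<open>\<Sum> |g\<^sub>j|\<close>; this bounds the excess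
potential by a multiple of \<open>\<Sum> g\<^sub>j\<^sup>2\<close>, which \<open>\<Sum> g\<^sub>j b(g\<^sub>j)\<close> dominates as long as the \<open>g\<^sub>j\<close> stay
bounded.

The rates \<open>w\<close> can be chosen as a continuous antimonotone positive function \<open>\<omega>\<close> of the level
(\<open>uniform_decay_rate\<close>), so \<open>U(t) \<le> U(0) exp(- \<omega>(U(0)) t)\<close>, a bound of class \<open>KL\<close>. By the time
\<open>U(0) / \<omega>(U(0))\<close> the trajectory has entered the set \<open>U \<le> 1\<close>, from where the rate \<open>\<omega>(1)\<close> applies;
moving the waiting time into the constant gives exponential convergence at a rate common to all
trajectories.

Finally, maximal solutions exist for all times (\<open>maximal_solution_global\<close>): a solution on a
half-open interval stays in a compact sublevel set, hence has Lipschitz coordinates and extends to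
the right endpoint, and from there Peano's theorem (\<open>peano_existence\<close>) continues it.\<close>

section \<open>Peano existence by Euler steps and compactness\<close>

lemma compact_coordinatewise:
  fixes S :: "'i \<Rightarrow> 'a::topological_space set"
  assumes "\<And>i. compact (S i)"
  shows "compact {x. \<forall>i. x i \<in> S i}"
proof -
  have "compactin (product_topology (\<lambda>_. euclidean) UNIV) (PiE UNIV S)"
    unfolding compactin_PiE using assms by simp
  moreover have "PiE UNIV S = {x. \<forall>i. x i \<in> S i}"
    by (auto simp: PiE_def Pi_def)
  ultimately show ?thesis
    by (simp add: euclidean_product_topology)
qed

text \<open>Uniform continuity with respect to the coordinates: the product metric is controlled by finitely
many coordinates up to a geometric tail.\<close>

lemma coordinatewise_uniformly_continuous:
  fixes f :: "('i::countable \<Rightarrow> real) \<Rightarrow> real"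
  assumes "compact B" and "continuous_on B f" and "0 < e"
  shows "\<exists>d>0. \<forall>x\<in>B. \<forall>y\<in>B. (\<forall>i. \<bar>x i - y i\<bar> \<le> d) \<longrightarrow> \<bar>f x - f y\<bar> < e"
proof -
  have "uniformly_continuous_on B f"
    using assms by (simp add: compact_uniformly_continuous)
  then have "\<exists>d>0. \<forall>x\<in>B. \<forall>y\<in>B. dist y x < d \<longrightarrow> dist (f y) (f x) < e"
    using \<open>0 < e\<close> by (simp only: uniformly_continuous_on_def)
  then obtain d where d: "d > 0" "\<And>x y. x \<in> B \<Longrightarrow> y \<in> B \<Longrightarrow> dist y x < d \<Longrightarrow> dist (f y) (f x) < e"
    by (elim exE conjE) (erule that, simp)
  obtain N where N: "(1/2::real)^N < d/2"
    using real_arch_pow_inv[of "d/2" "1/2"] d by auto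
  have "\<bar>f x - f y\<bar> < e" if "x \<in> B" "y \<in> B" "\<forall>i. \<bar>x i - y i\<bar> \<le> d/4" for x y
  proof -
    have "Max {dist (x (from_nat n)) (y (from_nat n)) |n. n \<le> N} \<le> d/4"
      using that(3) by (subst Max_le_iff) (auto simp: dist_real_def)
    then have "dist x y < d"
      using dist_fun_le_dist_first_terms[of x y N] N by linarith
    then show ?thesis
      using d(2)[of y x] that by (simp add: dist_real_def)
  qed
  moreover have "d/4 > 0" using d by simp
  ultimately show ?thesis by blast
qed

primrec euler :: "(('i \<Rightarrow> real) \<Rightarrow> 'i \<Rightarrow> real) \<Rightarrow> ('i \<Rightarrow> real) \<Rightarrow> real \<Rightarrow> nat \<Rightarrow> 'i \<Rightarrow> real" where
  "euler G a \<delta> 0 = a"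
| "euler G a \<delta> (Suc k) = (\<lambda>i. euler G a \<delta> k i + \<delta> * G (euler G a \<delta> k) i)"

text \<open>As long as the right-hand side stays within \<open>e\<close> of a constant \<open>c\<close>, each Euler step deviates from
slope \<open>c\<close> by at most \<open>\<delta> * e\<close>, and the deviations add up.\<close>

lemma euler_increment:
  assumes "j \<le> k" and "\<And>l. j \<le> l \<Longrightarrow> l < k \<Longrightarrow> \<bar>G (euler G a \<delta> l) i - c\<bar> \<le> e" and "0 \<le> \<delta>"
  shows "\<bar>euler G a \<delta> k i - euler G a \<delta> j i - (real k - real j) * \<delta> * c\<bar> \<le> (real k - real j) * \<delta> * e"
  using assms(1,2)
proof (induction k rule: dec_induct)
  case base
  then show ?case by simp
next
  case (step k)
  have "\<bar>\<delta> * (G (euler G a \<delta> k) i - c)\<bar> \<le> \<delta> * e"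
    using step.prems[of k] step.hyps \<open>0 \<le> \<delta>\<close> by (simp add: abs_mult mult_left_mono)
  moreover have "\<bar>euler G a \<delta> k i - euler G a \<delta> j i - (real k - real j) * \<delta> * c\<bar> \<le> (real k - real j) * \<delta> * e"
    using step by simp
  moreover have "euler G a \<delta> (Suc k) i - euler G a \<delta> j i - (real (Suc k) - real j) * \<delta> * c
     = (euler G a \<delta> k i - euler G a \<delta> j i - (real k - real j) * \<delta> * c) + \<delta> * (G (euler G a \<delta> k) i - c)"
    by (simp add: algebra_simps)
  moreover have "(real (Suc k) - real j) * \<delta> * e = (real k - real j) * \<delta> * e + \<delta> * e"
    by (simp add: algebra_simps)
  ultimately show ?case by linarith
qed

text \<open>A differential equation can be encoded by chords, that is by inequalities that involve finitely many
values of \<open>y\<close> each. Such inequalities pass to pointwise limits, which makes integral equations and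
uniform convergence superfluous in the existence proof. The evaluation point \<open>u\<close> may be either end
of the chord, so that left and right derivatives are covered at once.\<close>

lemma uniform_chord_derivative:
  fixes y :: "real \<Rightarrow> real"
  assumes "\<And>e. e > 0 \<Longrightarrow> \<exists>d>0. \<forall>s\<in>{0..h}. \<forall>t\<in>{s..h}. \<forall>u\<in>{s..t}. t - s < d \<longrightarrow> 
      \<bar>y t - y s - (t - s) * D u\<bar> \<le> e * (t - s)"
    and "u \<in> {0..h}"
  shows "(y has_real_derivative D u) (at u within {0..h})"
  unfolding has_field_derivative_iff Lim_within
proof (intro allI impI)
  fix e :: real
  assume e: "0 < e"
  obtain d where d: "d > 0" and *: "\<And>s t v. s \<in> {0..h} \<Longrightarrow> t \<in> {s..h} \<Longrightarrow> v \<in> {s..t} \<Longrightarrow> t - s < d \<Longrightarrow>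
      \<bar>y t - y s - (t - s) * D v\<bar> \<le> e/2 * (t - s)"
    using assms(1)[of "e/2"] half_gt_zero[OF e] by blast
  have "norm ((y x - y u) / (x - u) - D u) < e" if "x \<in> {0..h}" "x \<noteq> u" "\<bar>x - u\<bar> < d" for x
  proof -
    have "\<bar>y x - y u - (x - u) * D u\<bar> \<le> e/2 * \<bar>x - u\<bar>"
    proof (cases "u \<le> x")
      case True
      then show ?thesis using *[of u x u] that assms(2) by auto
    next
      case False
      then have "\<bar>y u - y x - (u - x) * D u\<bar> \<le> e/2 * (u - x)"
        using *[of x u u] that assms(2) by auto
      moreover have "y u - y x - (u - x) * D u = - (y x - y u - (x - u) * D u)"
        by (simp add: algebra_simps)
      ultimately have "\<bar>y x - y u - (x - u) * D u\<bar> \<le> e/2 * (u - x)"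
        by (simp only: abs_minus_cancel)
      moreover have "\<bar>x - u\<bar> = u - x" using False by simp
      ultimately show ?thesis by simp
    qed
    moreover have "(y x - y u) / (x - u) - D u = (y x - y u - (x - u) * D u) / (x - u)"
      using that by (simp add: field_simps)
    ultimately have "norm ((y x - y u) / (x - u) - D u) \<le> e/2"
      using that by (simp add: abs_divide pos_divide_le_eq)
    then show ?thesis using e by simp
  qed
  then show "\<exists>d>0. \<forall>x\<in>{0..h}. 0 < dist x u \<and> dist x u < d \<longrightarrow> dist ((y x - y u) / (x - u)) (D u) < e"
    using d by (auto intro!: exI[of _ d] simp: dist_real_def)
qed

text \<open>The Euler step functions with step sizes \<open>\<delta> k\<close> take values in the compact box \<open>B\<close>. By Tychonoff's
theorem the space of all functions from times to \<open>B\<close> is compact for pointwise convergence, so the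
step functions have a cluster point. Each of them satisfies the chord inequalities up to an error
that vanishes with \<open>\<delta> k\<close>, hence the cluster point satisfies them exactly.\<close>

theorem peano_existence:
  fixes F :: "('i::countable \<Rightarrow> real) \<Rightarrow> 'i \<Rightarrow> real"
  assumes "finite I" and "0 < r"
    and B_def: "B = {x. \<forall>i. x i \<in> cball (a i) (if i \<in> I then r else 0)}"
    and cont: "\<And>i. i \<in> I \<Longrightarrow> continuous_on B (\<lambda>x. F x i)"
  obtains h y where "h > 0" and "y 0 = a" and "\<And>t. t \<in> {0..h} \<Longrightarrow> y t \<in> B"
    and "\<And>t i. t \<in> {0..h} \<Longrightarrow> i \<in> I \<Longrightarrow>
           ((\<lambda>\<tau>. y \<tau> i) has_real_derivative F (y t) i) (at t within {0..h})"
proof -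
  have B: "compact B"
    unfolding B_def by (intro compact_coordinatewise compact_cball)
  have aB: "a \<in> B" using \<open>0 < r\<close> by (simp add: B_def)
  define G where "G = (\<lambda>x i. if i \<in> I then F x i else 0)"
  have "\<exists>m. \<forall>x\<in>B. \<bar>G x i\<bar> \<le> m" if "i \<in> I" for i
  proof -
    have "compact ((\<lambda>x. F x i) ` B)"
      using B cont[OF that] by (intro compact_continuous_image)
    then show ?thesis
      using that unfolding G_def bounded_iff by (auto dest!: compact_imp_bounded simp: bounded_iff)
  qed
  then obtain m where m: "\<And>i x. i \<in> I \<Longrightarrow> x \<in> B \<Longrightarrow> \<bar>G x i\<bar> \<le> m i" by metis
  define M where "M = 1 + (\<Sum>i\<in>I. \<bar>m i\<bar>)"
  have M: "M \<ge> 1" "\<And>i x. x \<in> B \<Longrightarrow> \<bar>G x i\<bar> \<le> M"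
  proof -
    show "M \<ge> 1" by (simp add: M_def sum_nonneg)
    fix i x assume "x \<in> B"
    show "\<bar>G x i\<bar> \<le> M"
    proof (cases "i \<in> I")
      case True
      have "\<bar>m i\<bar> \<le> (\<Sum>i\<in>I. \<bar>m i\<bar>)"
        using True \<open>finite I\<close> by (intro member_le_sum) auto
      then show ?thesis using m[OF True \<open>x \<in> B\<close>] by (simp add: M_def)
    next
      case False
      then show ?thesis using \<open>M \<ge> 1\<close> by (simp add: G_def)
    qed
  qed
  \<comment> \<open>Euler steps of slope at most \<open>M\<close> cannot leave the box before time \<open>r / M\<close>.\<close>
  define h where "h = r / M"
  have h: "h > 0" "h * M = r" using M(1) \<open>0 < r\<close> by (simp_all add: h_def)
  define \<delta> :: "nat \<Rightarrow> real" where "\<delta> = (\<lambda>k. 1 / (real k + 1))"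
  have \<delta>: "\<delta> k > 0" for k by (simp add: \<delta>_def)
  have earlier: "real q * \<delta> k \<le> h" if "q \<le> l" "real l * \<delta> k \<le> h" for q l k
    using mult_right_mono[of "real q" "real l" "\<delta> k"] that \<delta>[of k] by linarith
  have E_B: "euler G a (\<delta> k) j \<in> B" if "real j * \<delta> k \<le> h" for k j
    using that
  proof (induction j rule: less_induct)
    case (less j)
    have EB: "euler G a (\<delta> k) l \<in> B" if "l < j" for l
      using that earlier[of l j k] less.prems by (intro less.IH) simp_all
    have "\<bar>G (euler G a (\<delta> k) l) i - 0\<bar> \<le> (if i \<in> I then M else 0)" if "l < j" for l i
      using M(2)[of "euler G a (\<delta> k) l" i] EB that by (cases "i \<in> I") (simp_all add: G_def)
    then have *: "\<bar>euler G a (\<delta> k) j i - a i\<bar> \<le> real j * \<delta> k * (if i \<in> I then M else 0)" for i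
      using euler_increment[of 0 j G a "\<delta> k" i 0 "if i \<in> I then M else 0"] \<delta>[of k] by simp
    have "real j * \<delta> k * M \<le> r"
      using less.prems M(1) h by (metis mult_right_mono order.trans zero_le_one)
    then have "\<bar>euler G a (\<delta> k) j i - a i\<bar> \<le> (if i \<in> I then r else 0)" for i
      using *[of i] by (cases "i \<in> I") auto
    then show ?case by (simp add: B_def dist_real_def abs_minus_commute)
  qed
  have E_step: "\<bar>euler G a (\<delta> k) l i - euler G a (\<delta> k) j i\<bar> \<le> (real l - real j) * \<delta> k * M"
    if "j \<le> l" "real l * \<delta> k \<le> h" for k l j i
  proof -
    have "euler G a (\<delta> k) q \<in> B" if "q < l" for q
      using earlier[of q l k] that \<open>real l * \<delta> k \<le> h\<close> by (intro E_B) simp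
    then show ?thesis
      using euler_increment[of j l G a "\<delta> k" i 0 M] that(1) M(2) \<delta>[of k] by simp
  qed
  define N where "N = (\<lambda>k t. nat \<lfloor>t / \<delta> k\<rfloor>)"
  have N: "real (N k t) * \<delta> k \<le> t" "t < (real (N k t) + 1) * \<delta> k" if "0 \<le> t" for k t
  proof -
    have eq: "real (N k t) = of_int \<lfloor>t / \<delta> k\<rfloor>"
      using that \<delta>[of k] by (simp add: N_def)
    show "real (N k t) * \<delta> k \<le> t" "t < (real (N k t) + 1) * \<delta> k"
      unfolding eq using \<delta>[of k]
      by (simp_all flip: pos_le_divide_eq pos_divide_less_eq)
  qed
  have N_mono: "N k s \<le> N k t" if "s \<le> t" for k s t
    unfolding N_def using that \<delta>[of k] by (intro nat_mono floor_mono divide_right_mono) auto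
  define Y where "Y = (\<lambda>k t. if t \<in> {0..h} then euler G a (\<delta> k) (N k t) else a)"
  define K where "K = {z :: real \<Rightarrow> 'i \<Rightarrow> real. \<forall>t. z t \<in> B}"
  have Y_K: "Y k \<in> K" for k
  proof -
    have "Y k t \<in> B" for t
    proof (cases "t \<in> {0..h}")
      case True
      then show ?thesis using E_B[of "N k t" k] N(1)[of t k] by (simp add: Y_def)
    qed (use aB in \<open>simp only: Y_def if_False\<close>)
    then show ?thesis by (simp add: K_def)
  qed
  have "compact K" unfolding K_def by (intro compact_coordinatewise B)
  then obtain y where y: "y \<in> K" "inf (nhds y) (filtermap Y sequentially) \<noteq> bot"
    using Y_K unfolding compact_filter
    by (auto simp: filtermap_bot_iff eventually_filtermap
        dest!: spec[of _ "filtermap Y sequentially"])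
  \<comment> \<open>Along \<open>FF\<close>, a refinement of the sequence, the step functions converge pointwise to \<open>y\<close>.\<close>
  define FF where "FF = inf (nhds y) (filtermap Y sequentially)"
  have FF: "FF \<noteq> bot" "FF \<le> nhds y" "\<And>P. (\<forall>\<^sub>F k in sequentially. P (Y k)) \<Longrightarrow> eventually P FF"
    using y(2) by (auto simp: FF_def eventually_filtermap intro: filter_leD[OF inf_le2])
  have lim_t: "((\<lambda>z. z t) \<longlongrightarrow> y t) FF" for t
  proof (rule topological_tendstoI)
    fix S :: "('i \<Rightarrow> real) set" assume S: "open S" "y t \<in> S"
    have "open ((\<lambda>z::real \<Rightarrow> 'i \<Rightarrow> real. z t) -` S)"
      using S(1) continuous_on_product_coordinates by (rule open_vimage)
    then have "\<forall>\<^sub>F z in nhds y. z \<in> (\<lambda>z. z t) -` S"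
      by (rule eventually_nhds_in_open) (use S(2) in simp)
    then show "\<forall>\<^sub>F z in FF. z t \<in> S"
      using FF(2) by (auto intro: filter_leD)
  qed
  have lim: "((\<lambda>z. z t i) \<longlongrightarrow> y t i) FF" for t i
  proof -
    have "continuous_on UNIV (\<lambda>x::'i \<Rightarrow> real. x i)"
      by (rule continuous_on_product_coordinates)
    then have "isCont (\<lambda>x::'i \<Rightarrow> real. x i) (y t)"
      using continuous_on_eq_continuous_at[OF open_UNIV] by blast
    then show ?thesis using lim_t by (rule isCont_tendsto_compose)
  qed
  have limG: "((\<lambda>z. G (z t) i) \<longlongrightarrow> G (y t) i) FF" for t i
  proof -
    have "continuous_on B (\<lambda>x. G x i)" using cont[of i] by (cases "i \<in> I") (auto simp: G_def)
    moreover have "y t \<in> B" using y(1) by (simp add: K_def)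
    moreover have "\<forall>\<^sub>F z in FF. z t \<in> B"
      by (rule FF(3)) (use Y_K in \<open>auto simp: K_def\<close>)
    ultimately show ?thesis by (rule continuous_on_tendsto_compose[OF _ lim_t])
  qed
  have "y 0 = a"
  proof
    fix i
    have "\<forall>\<^sub>F z in FF. z 0 i = a i"
      by (rule FF(3)) (simp add: Y_def N_def h less_imp_le)
    then have "((\<lambda>z. z 0 i) \<longlongrightarrow> a i) FF" by (rule tendsto_eventually)
    with FF(1) lim[of 0 i] show "y 0 i = a i" by (rule tendsto_unique)
  qed
  have deriv: "((\<lambda>\<tau>. y \<tau> i) has_real_derivative F (y u) i) (at u within {0..h})"
    if "u \<in> {0..h}" "i \<in> I" for u i
  proof -
    have "\<exists>d>0. \<forall>s\<in>{0..h}. \<forall>t\<in>{s..h}. \<forall>u\<in>{s..t}. t - s < d \<longrightarrow>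
      \<bar>y t i - y s i - (t - s) * G (y u) i\<bar> \<le> e * (t - s)" if "e > 0" for e
    proof -
      have "continuous_on B (\<lambda>x. G x i)" using cont[of i] by (cases "i \<in> I") (auto simp: G_def)
      then obtain d where d: "d > 0" "\<And>x z. x \<in> B \<Longrightarrow> z \<in> B \<Longrightarrow> (\<And>i. \<bar>x i - z i\<bar> \<le> d) \<Longrightarrow> \<bar>G x i - G z i\<bar> < e"
        using coordinatewise_uniformly_continuous[OF B _ \<open>e > 0\<close>, of "\<lambda>x. G x i"] by blast
      \<comment> \<open>A chord of length \<open>d2\<close> and one further step of length \<open>d2\<close> change the coordinates by at most \<open>d\<close>.\<close>
      define d2 where "d2 = d / (2 * M)"
      have d2: "d2 > 0" "2 * d2 * M = d" using d(1) M(1) by (simp_all add: d2_def)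
      have "\<bar>y t i - y s i - (t - s) * G (y u) i\<bar> \<le> e * (t - s)"
        if s: "s \<in> {0..h}" and t: "t \<in> {s..h}" and u: "u \<in> {s..t}" and ts: "t - s < d2" for s t u
      proof -
        have ev: "\<bar>Y k t i - Y k s i - (t - s) * G (Y k u) i\<bar> \<le> e * (t - s) + \<delta> k * (e + M)"
          if k: "\<delta> k \<le> d2" for k
        proof -
          let ?E = "euler G a (\<delta> k)"
          define j l p where "j = N k s" and "l = N k t" and "p = N k u"
          have jl: "j \<le> p" "p \<le> l" using s t u by (auto simp: j_def l_def p_def intro!: N_mono)
          have lh: "real l * \<delta> k \<le> h" using N(1)[of t k] s t by (simp add: l_def)
          have diff: "\<bar>(real l - real j) * \<delta> k - (t - s)\<bar> \<le> \<delta> k"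
            using N[of s k] N[of t k] s t by (simp add: j_def l_def algebra_simps abs_le_iff)
          have inB: "?E q \<in> B" if "q \<le> l" for q
            using E_B[OF earlier[OF that lh]] .
          have near: "\<bar>?E q i' - ?E p i'\<bar> \<le> d" if "j \<le> q" "q \<le> l" for q i'
          proof -
            have "\<bar>?E q i' - ?E p i'\<bar> \<le> \<bar>real q - real p\<bar> * \<delta> k * M"
            proof (cases "p \<le> q")
              case True
              then show ?thesis using E_step[of p q k i'] earlier[OF that(2) lh] by simp
            next
              case False
              have "real p * \<delta> k \<le> h"
                using jl(2) lh by (rule earlier)
              then show ?thesis using E_step[of q p k i'] False by (simp add: abs_minus_commute)
            qed
            also have "\<dots> \<le> (real l - real j) * \<delta> k * M"
              using that jl \<delta>[of k] M(1) by (intro mult_right_mono) (auto simp: abs_le_iff)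
            also have "\<dots> \<le> 2 * d2 * M"
              using diff k ts M(1) by (intro mult_right_mono) auto
            finally show ?thesis by (simp add: d2)
          qed
          have "\<bar>?E l i - ?E j i - (real l - real j) * \<delta> k * G (?E p) i\<bar> \<le> (real l - real j) * \<delta> k * e"
          proof (rule euler_increment)
            fix q assume "j \<le> q" "q < l"
            then show "\<bar>G (?E q) i - G (?E p) i\<bar> \<le> e"
              using d(2)[of "?E q" "?E p"] near[of q] inB jl by (simp add: less_imp_le)
          qed (use jl \<delta>[of k] in auto)
          moreover have "(real l - real j) * \<delta> k * e \<le> (t - s + \<delta> k) * e"
            using diff \<open>e > 0\<close> by (intro mult_right_mono) auto
          moreover have "\<bar>((real l - real j) * \<delta> k - (t - s)) * G (?E p) i\<bar> \<le> \<delta> k * M"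
            unfolding abs_mult using diff M(2)[OF inB[OF jl(2)]] \<delta>[of k] by (intro mult_mono) auto
          moreover have "?E l i - ?E j i - (t - s) * G (?E p) i =
            (?E l i - ?E j i - (real l - real j) * \<delta> k * G (?E p) i) + ((real l - real j) * \<delta> k - (t - s)) * G (?E p) i"
            by (simp add: algebra_simps)
          ultimately have "\<bar>?E l i - ?E j i - (t - s) * G (?E p) i\<bar> \<le> (t - s + \<delta> k) * e + \<delta> k * M"
            by linarith
          moreover have "Y k t = ?E l" "Y k s = ?E j" "Y k u = ?E p"
            using s t u by (auto simp: Y_def l_def j_def p_def)
          ultimately show ?thesis by (simp add: algebra_simps)
        qed
        have \<delta>_lim: "\<delta> \<longlonglongrightarrow> 0"
          unfolding \<delta>_def using LIMSEQ_inverse_real_of_nat by (simp add: inverse_eq_divide add.commute)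
        show ?thesis
        proof (rule field_le_epsilon)
          fix e' :: real assume "e' > 0"
          have "(\<lambda>k. \<delta> k * (e + M)) \<longlonglongrightarrow> 0"
            using tendsto_mult_left_zero[OF \<delta>_lim] .
          then have "\<forall>\<^sub>F k in sequentially. \<delta> k * (e + M) < e'"
            using \<open>e' > 0\<close> by (rule order_tendstoD)
          moreover have "\<forall>\<^sub>F k in sequentially. \<delta> k < d2"
            using \<delta>_lim d2(1) by (rule order_tendstoD)
          ultimately have "\<forall>\<^sub>F k in sequentially. \<bar>Y k t i - Y k s i - (t - s) * G (Y k u) i\<bar> \<le> e * (t - s) + e'"
          proof eventually_elim
            case (elim k)
            then show ?case using ev[of k] by linarith
          qed
          then have "\<forall>\<^sub>F z in FF. \<bar>z t i - z s i - (t - s) * G (z u) i\<bar> \<le> e * (t - s) + e'"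
            by (rule FF(3))
          moreover have "((\<lambda>z. \<bar>z t i - z s i - (t - s) * G (z u) i\<bar>) \<longlongrightarrow> \<bar>y t i - y s i - (t - s) * G (y u) i\<bar>) FF"
            by (intro tendsto_intros lim limG)
          ultimately show "\<bar>y t i - y s i - (t - s) * G (y u) i\<bar> \<le> e * (t - s) + e'"
            using tendsto_upperbound[OF _ _ FF(1)] by blast
        qed
      qed
      then show ?thesis using d2(1) by blast
    qed
    from uniform_chord_derivative[OF this \<open>u \<in> {0..h}\<close>]
    have "((\<lambda>\<tau>. y \<tau> i) has_real_derivative G (y u) i) (at u within {0..h})" .
    then show ?thesis using \<open>i \<in> I\<close> by (simp add: G_def)
  qed
  show ?thesis
    using that[of h y] h(1) \<open>y 0 = a\<close> y(1) deriv by (auto simp: K_def)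
qed

section \<open>Endpoints of solution intervals\<close>

text \<open>L'Hospital's rule, applied to the difference quotient at \<open>b\<close>.\<close>

lemma derivative_at_right_endpoint:
  fixes y :: "real \<Rightarrow> real"
  assumes "a < b" and "continuous_on {a..b} y"
    and "\<And>t. t \<in> {a<..<b} \<Longrightarrow> (y has_real_derivative D t) (at t)"
    and "(D \<longlongrightarrow> l) (at_left b)"
  shows "(y has_real_derivative l) (at b within {a..b})"
proof -
  have ab: "at b within {a..b} = at_left b" using \<open>a < b\<close> by (rule at_within_Icc_at_left)
  have ev: "\<forall>\<^sub>F t in at_left b. t \<in> {a<..<b}"
    using \<open>a < b\<close> by (intro eventually_at_leftI[of a]) auto
  have "((\<lambda>t. (y t - y b) / (t - b)) \<longlongrightarrow> l) (at_left b)"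
  proof (rule lhopital_left)
    have "(y \<longlongrightarrow> y b) (at_left b)"
      using assms(1,2) unfolding continuous_on_def by (auto simp flip: ab)
    then show "((\<lambda>t. y t - y b) \<longlongrightarrow> 0) (at_left b)"
      by (rule LIM_zero)
    show "((\<lambda>t. t - b) \<longlongrightarrow> 0) (at_left b)"
      by (rule LIM_zero) (rule tendsto_ident_at)
    show "\<forall>\<^sub>F t in at_left b. t - b \<noteq> 0"
      using ev by eventually_elim simp
    show "\<forall>\<^sub>F t in at_left b. ((\<lambda>t. y t - y b) has_real_derivative D t) (at t)"
      using ev by eventually_elim (auto intro!: derivative_eq_intros assms(3))
    show "\<forall>\<^sub>F t in at_left b. ((\<lambda>t. t - b) has_real_derivative 1) (at t)"
      by (auto intro!: always_eventually derivative_eq_intros)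
    show "((\<lambda>t. D t / 1) \<longlongrightarrow> l) (at_left b)" using assms(4) by simp
  qed simp
  then show ?thesis by (simp add: has_field_derivative_iff ab)
qed

lemma has_real_derivative_within_Un:
  fixes f :: "real \<Rightarrow> real"
  assumes "(f has_real_derivative D) (at x within S)" "(f has_real_derivative D) (at x within T)"
  shows "(f has_real_derivative D) (at x within (S \<union> T))"
  using assms unfolding has_field_derivative_iff by (rule Lim_within_Un[THEN iffD2, OF conjI])

lemma has_real_derivative_cong_within:
  fixes f g :: "real \<Rightarrow> real"
  assumes "(f has_real_derivative D) (at t within S)" "t \<in> S" "\<And>s. s \<in> S \<Longrightarrow> g s = f s"
  shows "(g has_real_derivative D) (at t within S)"
  using has_derivative_transform[of t S g f "(*) D"] assms by (simp add: has_field_derivative_def)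

text \<open>A bounded derivative makes \<open>u\<close> Lipschitz, hence uniformly continuous, hence continuously extendable
to the closure of its domain.\<close>

lemma bounded_derivative_extension:
  fixes u :: "real \<Rightarrow> real"
  assumes "0 < T" and "\<And>t. t \<in> {0..<T} \<Longrightarrow> (u has_real_derivative u' t) (at t within {0..<T})"
    and "\<And>t. t \<in> {0..<T} \<Longrightarrow> \<bar>u' t\<bar> \<le> M"
  obtains g where "continuous_on {0..T} g" "\<And>t. t \<in> {0..<T} \<Longrightarrow> g t = u t"
proof -
  have M: "0 \<le> M" using assms(3)[of 0] \<open>0 < T\<close> by auto
  have "M-lipschitz_on {0..<T} u"
  proof (rule lipschitz_onI)
    fix x y assume xy: "x \<in> {0..<T}" "y \<in> {0..<T}"
    have "norm (u x - u y) \<le> M * norm (x - y)"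
      by (rule field_differentiable_bound[OF _ assms(2)]) (use xy assms(3) in auto)
    then show "dist (u x) (u y) \<le> M * dist x y" by (simp add: dist_norm)
  qed (rule M)
  then have "uniformly_continuous_on {0..<T} u" by (rule lipschitz_on_uniformly_continuous)
  then obtain g where "uniformly_continuous_on (closure {0..<T}) g" "\<And>x. x \<in> {0..<T} \<Longrightarrow> u x = g x"
    by (rule uniformly_continuous_on_extension_on_closure) (rule that; assumption)
  then show ?thesis
    using that[of g] \<open>0 < T\<close> by (simp add: uniformly_continuous_imp_continuous)
qed

section \<open>Growth and convexity at a point\<close>

text \<open>Near \<open>p\<close> the derivative gives linear growth. Farther away monotonicity preserves what has been gained
at distance \<open>e\<close>, and on a bounded interval a constant gain is still linear growth with a smaller
slope.\<close>

lemma monotone_growth_at_point: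
  fixes h :: "real \<Rightarrow> real"
  assumes mono: "mono_on {a<..<b} h" and p: "a < p" "p < b"
    and "(h has_real_derivative l) (at p)" and "l > 0"
  shows "\<exists>c>0. \<forall>x\<in>{a<..<b}. c * \<bar>x - p\<bar> \<le> \<bar>h x - h p\<bar>"
proof -
  have "(\<lambda>x. (h x - h p) / (x - p)) \<midarrow>p\<rightarrow> l"
    using assms(4) by (simp add: has_field_derivative_iff)
  from LIM_D[OF this, of "l/2"] obtain d where d: "d > 0"
    "\<And>x. x \<noteq> p \<Longrightarrow> \<bar>x - p\<bar> < d \<Longrightarrow> \<bar>(h x - h p) / (x - p) - l\<bar> < l/2"
    using \<open>l > 0\<close> by auto
  have near: "l/2 * \<bar>x - p\<bar> \<le> \<bar>h x - h p\<bar>" if "\<bar>x - p\<bar> < d" for x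
  proof (cases "x = p")
    case False
    have "l/2 \<le> (h x - h p) / (x - p)"
      using d(2)[OF False that] by linarith
    also have "\<dots> \<le> \<bar>h x - h p\<bar> / \<bar>x - p\<bar>"
      by (metis abs_divide abs_ge_self)
    finally show ?thesis using False by (simp add: pos_le_divide_eq)
  qed simp
  \<comment> \<open>The points \<open>p - e\<close> and \<open>p + e\<close> lie in the interval and within the range of the linear bound.\<close>
  define e where "e = min (d/2) (min ((p - a)/2) ((b - p)/2))"
  have e: "0 < e" "e < d" "a < p - e" "p + e < b"
    using d(1) p by (auto simp: e_def min_def field_simps)
  \<comment> \<open>The gain \<open>l/2 * e\<close> at distance \<open>e\<close>, spread over the length of the whole interval.\<close>
  define c where "c = l/2 * (e / (b - a))"
  have eba: "0 < e / (b - a)" "e / (b - a) \<le> 1" using e p by (simp_all add: field_simps)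
  have c: "c > 0" "c \<le> l/2"
  proof -
    show "c > 0" unfolding c_def using \<open>l > 0\<close> eba(1) by (intro mult_pos_pos) simp_all
    show "c \<le> l/2" unfolding c_def using \<open>l > 0\<close> mult_left_mono[OF eba(2), of "l/2"] by simp
  qed
  have "c * \<bar>x - p\<bar> \<le> \<bar>h x - h p\<bar>" if x: "a < x" "x < b" for x
  proof (cases "\<bar>x - p\<bar> < d")
    case True
    then show ?thesis using near[OF True] c by (meson abs_ge_zero mult_right_mono order.trans)
  next
    case False
    have "c * \<bar>x - p\<bar> \<le> c * (b - a)"
      using x p c by (intro mult_left_mono) auto
    also have "\<dots> = l/2 * (e / (b - a) * (b - a))" by (simp only: c_def mult.assoc)
    also have "\<dots> = l/2 * e" using p by simp
    also have "\<dots> \<le> \<bar>h x - h p\<bar>"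
    proof (cases "p \<le> x")
      case True
      then have "h (p + e) \<le> h x" "h p \<le> h (p + e)"
        using False e p x by (auto intro!: mono_onD[OF mono])
      then show ?thesis using near[of "p + e"] e by auto
    next
      case p': False
      then have "h x \<le> h (p - e)" "h (p - e) \<le> h p"
        using False e p x by (auto intro!: mono_onD[OF mono])
      then show ?thesis using near[of "p - e"] e by auto
    qed
    finally show ?thesis .
  qed
  then show ?thesis using c(1) by auto
qed

lemma differentiable_linear_bound:
  fixes h :: "real \<Rightarrow> real"
  assumes "(h has_real_derivative l) (at p)"
  shows "\<exists>d>0. \<forall>x. \<bar>x - p\<bar> < d \<longrightarrow> \<bar>h x - h p\<bar> \<le> (\<bar>l\<bar> + 1) * \<bar>x - p\<bar>"
proof -
  have "(\<lambda>x. (h x - h p) / (x - p)) \<midarrow>p\<rightarrow> l"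
    using assms by (simp add: has_field_derivative_iff)
  from LIM_D[OF this, of 1] obtain d where d: "d > 0"
    "\<And>x. x \<noteq> p \<Longrightarrow> \<bar>x - p\<bar> < d \<Longrightarrow> \<bar>(h x - h p) / (x - p) - l\<bar> < 1" by auto
  have "\<bar>h x - h p\<bar> \<le> (\<bar>l\<bar> + 1) * \<bar>x - p\<bar>" if "\<bar>x - p\<bar> < d" for x
  proof (cases "x = p")
    case False
    have "\<bar>(h x - h p) / (x - p)\<bar> \<le> \<bar>l\<bar> + 1"
      using d(2)[OF False that] by linarith
    then show ?thesis using False by (simp add: abs_divide pos_divide_le_eq)
  qed simp
  then show ?thesis using d(1) by blast
qed

text \<open>Near \<open>(p, p)\<close> this follows from differentiability of \<open>h\<close> and \<open>b\<close>. Away from \<open>(p, p)\<close> the right-hand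
side is bounded below, so boundedness of \<open>b\<close> suffices, even where \<open>h\<close> is unbounded.\<close>

lemma bounded_composition_linear_bound:
  fixes h b :: "real \<Rightarrow> real"
  assumes "(h has_real_derivative l) (at p)" and "(b has_real_derivative k) (at 0)" and "b 0 = 0"
    and bdd: "\<And>z. \<bar>b z\<bar> \<le> M"
  shows "\<exists>C>0. \<forall>x y. \<bar>b (h x - h y)\<bar> \<le> C * (\<bar>x - p\<bar> + \<bar>y - p\<bar>)"
proof -
  define A B where "A = \<bar>l\<bar> + 1" and "B = \<bar>k\<bar> + 1"
  have AB: "A > 0" "B > 0" by (auto simp: A_def B_def)
  obtain d where d: "d > 0" "\<And>x. \<bar>x - p\<bar> < d \<Longrightarrow> \<bar>h x - h p\<bar> \<le> A * \<bar>x - p\<bar>"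
    using differentiable_linear_bound[OF assms(1)] by (auto simp: A_def)
  obtain e where e: "e > 0" "\<And>z. \<bar>z\<bar> < e \<Longrightarrow> \<bar>b z\<bar> \<le> B * \<bar>z\<bar>"
    using differentiable_linear_bound[OF assms(2)] assms(3) by (auto simp: B_def)
  \<comment> \<open>If the distances of both arguments from \<open>p\<close> add up to less than \<open>q\<close>, the difference of the values of \<open>h\<close> is below \<open>e\<close>.\<close>
  define q where "q = min d (e / A)"
  have q: "q > 0" "q \<le> d" "A * q \<le> e" using d e AB by (auto simp: q_def min_def field_simps)
  have M: "M \<ge> 0" using bdd[of 0] by linarith
  define C where "C = B * A + M / q"
  have C: "C > 0" "C \<ge> B * A" "C * q \<ge> M" 
    using AB M q by (auto simp: C_def distrib_right intro!: add_pos_nonneg)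
  have "\<bar>b (h x - h y)\<bar> \<le> C * (\<bar>x - p\<bar> + \<bar>y - p\<bar>)" for x y
  proof (cases "\<bar>x - p\<bar> + \<bar>y - p\<bar> < q")
    case True
    have *: "\<bar>h x - h y\<bar> \<le> A * (\<bar>x - p\<bar> + \<bar>y - p\<bar>)"
    proof -
      have "\<bar>x - p\<bar> < d" "\<bar>y - p\<bar> < d" using True q by linarith+
      then show ?thesis using d(2)[of x] d(2)[of y] unfolding distrib_left by linarith
    qed
    also have "\<dots> < e" using True q AB by (smt (verit) mult_strict_left_mono)
    finally have "\<bar>b (h x - h y)\<bar> \<le> B * \<bar>h x - h y\<bar>" by (rule e(2))
    also have "\<dots> \<le> B * (A * (\<bar>x - p\<bar> + \<bar>y - p\<bar>))"
      using * AB by (intro mult_left_mono) auto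
    also have "\<dots> \<le> C * (\<bar>x - p\<bar> + \<bar>y - p\<bar>)"
      using C(2) by (simp add: mult_right_mono flip: mult.assoc)
    finally show ?thesis .
  next
    case False
    then have "C * q \<le> C * (\<bar>x - p\<bar> + \<bar>y - p\<bar>)" using C(1) by (intro mult_left_mono) auto
    then show ?thesis using bdd[of "h x - h y"] C(3) by linarith
  qed
  then show ?thesis using C(1) by blast
qed

text \<open>The difference of the two sides has a derivative in \<open>x\<close> with the sign of \<open>x - p\<close>. With \<open>c = 0\<close> this is
the tangent inequality for convex functions.\<close>

lemma strong_convexity_at_point:
  fixes V h :: "real \<Rightarrow> real"
  assumes deriv: "\<And>x. x \<in> {a<..<b} \<Longrightarrow> (V has_real_derivative h x) (at x)"
    and mono: "mono_on {a<..<b} h" and p: "p \<in> {a<..<b}"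
    and growth: "\<And>x. x \<in> {a<..<b} \<Longrightarrow> c * \<bar>x - p\<bar> \<le> \<bar>h x - h p\<bar>"
    and x: "x \<in> {a<..<b}"
  shows "V p + h p * (x - p) + c/2 * (x - p)\<^sup>2 \<le> V x"
proof -
  define \<phi> where "\<phi> = (\<lambda>x. V x - h p * (x - p) - c/2 * (x - p)\<^sup>2)"
  have D: "(\<phi> has_real_derivative h z - h p - c * (z - p)) (at z)" if "z \<in> {a<..<b}" for z
    unfolding \<phi>_def by (auto intro!: derivative_eq_intros deriv[OF that])
  have cont: "continuous_on {u..v} \<phi>" if "a < u" "v < b" for u v
    using that by (intro DERIV_atLeastAtMost_imp_continuous_on) (auto intro!: exI D)
  have "\<phi> p \<le> \<phi> x"
  proof (cases "p \<le> x")
    case True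
    show ?thesis
    proof (rule DERIV_nonneg_imp_increasing_open[OF True])
      fix z assume z: "p < z" "z < x"
      then have "z \<in> {a<..<b}" using p x by auto
      moreover have "h p \<le> h z" using z p x by (intro mono_onD[OF mono]) auto
      ultimately show "\<exists>y. DERIV \<phi> z :> y \<and> 0 \<le> y"
        using D[of z] growth[of z] z by (intro exI conjI) auto
    qed (use p x cont in auto)
  next
    case False
    show ?thesis
    proof (rule DERIV_nonpos_imp_decreasing_open[of x p \<phi>])
      show "x \<le> p" using False by simp
      fix z assume z: "x < z" "z < p"
      then have zz: "z \<in> {a<..<b}" using p x by auto
      moreover have "h z \<le> h p" using z p x by (intro mono_onD[OF mono]) auto
      ultimately have "h z - h p - c * (z - p) \<le> 0"
        using growth[of z] z by (simp add: algebra_simps)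
      then show "\<exists>y. DERIV \<phi> z :> y \<and> y \<le> 0"
        using D[OF zz] by blast
    qed (use p x cont in auto)
  qed
  then show ?thesis by (simp add: \<phi>_def)
qed

section \<open>Decay rates and comparison functions\<close>

text \<open>Gronwall's argument: \<open>u \<tau> * exp (w * \<tau>)\<close> does not increase.\<close>

lemma exponential_decay:
  fixes u :: "real \<Rightarrow> real"
  assumes "0 \<le> t" and deriv: "\<And>\<tau>. \<tau> \<in> {0..t} \<Longrightarrow> (u has_real_derivative - d \<tau>) (at \<tau> within {0..t})"
    and rate: "\<And>\<tau>. \<tau> \<in> {0..t} \<Longrightarrow> w * u \<tau> \<le> d \<tau>"
  shows "u t \<le> u 0 * exp (- w * t)"
proof -
  have D: "((\<lambda>\<tau>. u \<tau> * exp (w * \<tau>)) has_real_derivative (w * u \<tau> - d \<tau>) * exp (w * \<tau>)) (at \<tau> within {0..t})"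
    if "\<tau> \<in> {0..t}" for \<tau>
    by (auto intro!: derivative_eq_intros deriv[OF that] simp: algebra_simps)
  have "u 0 * exp (w * 0) \<ge> u t * exp (w * t)"
  proof (rule DERIV_nonpos_imp_decreasing_open[OF \<open>0 \<le> t\<close>])
    show "continuous_on {0..t} (\<lambda>\<tau>. u \<tau> * exp (w * \<tau>))"
      using D by (rule DERIV_continuous_on)
    fix \<tau> assume \<tau>: "0 < \<tau>" "\<tau> < t"
    then have "((\<lambda>\<tau>. u \<tau> * exp (w * \<tau>)) has_real_derivative (w * u \<tau> - d \<tau>) * exp (w * \<tau>)) (at \<tau>)"
      using D[of \<tau>] by (simp add: at_within_Icc_at)
    moreover have "(w * u \<tau> - d \<tau>) * exp (w * \<tau>) \<le> 0"
      using rate[of \<tau>] \<tau> by (intro mult_nonpos_nonneg) auto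
    ultimately show "\<exists>y. DERIV (\<lambda>\<tau>. u \<tau> * exp (w * \<tau>)) \<tau> :> y \<and> y \<le> 0" by blast
  qed
  then have "u t * exp (w * t) * exp (- w * t) \<le> u 0 * exp (- w * t)"
    by (intro mult_right_mono) auto
  then show ?thesis by (simp add: mult.assoc flip: exp_add)
qed

text \<open>Rates that are valid on each single sublevel set are glued to one continuous function of the level.
The function is the infimum of the quotients \<open>D x / U x\<close>, where points above the level \<open>r\<close> are not
excluded but penalised by their excess; each competitor is 1-Lipschitz and antimonotone in \<open>r\<close>, and
so is the infimum.\<close>

lemma uniform_decay_rate:
  fixes U D :: "'a \<Rightarrow> real"
  assumes "\<And>r. \<exists>w>0. \<forall>x\<in>X. U x \<le> r \<longrightarrow> w * U x \<le> D x"
  obtains \<omega> :: "real \<Rightarrow> real" where "continuous_on UNIV \<omega>" and "antimono \<omega>" and "\<And>r. \<omega> r > 0"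
    and "\<And>x r. x \<in> X \<Longrightarrow> 0 \<le> U x \<Longrightarrow> U x \<le> r \<Longrightarrow> \<omega> r * U x \<le> D x"
proof -
  have D0: "0 \<le> D x" if "x \<in> X" "U x > 0" for x
    using assms[of "U x"] that by (meson less_eq_real_def mult_nonneg_nonneg order.trans)
  \<comment> \<open>The element \<open>1\<close> keeps the set nonempty if \<open>U\<close> is nowhere positive on \<open>X\<close>.\<close>
  define A where "A = (\<lambda>r. insert 1 ((\<lambda>x. D x / U x + max 0 (U x - r)) ` {x\<in>X. U x > 0}))"
  define \<omega> where "\<omega> = (\<lambda>r. Inf (A r))"
  have bdd: "bdd_below (A r)" for r
    using D0 by (intro bdd_belowI[of _ 0]) (auto simp: A_def)
  have ne: "A r \<noteq> {}" for r by (simp add: A_def)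
  have lip: "\<omega> s \<le> \<omega> r + \<bar>r - s\<bar>" for r s
  proof -
    have "\<omega> s - \<bar>r - s\<bar> \<le> \<omega> r"
      unfolding \<omega>_def
    proof (rule cInf_greatest[OF ne])
      fix z assume z: "z \<in> A r"
      show "Inf (A s) - \<bar>r - s\<bar> \<le> z"
      proof (cases "z = 1")
        case True
        have "Inf (A s) \<le> 1" by (rule cInf_lower[OF _ bdd]) (simp add: A_def)
        then show ?thesis using True by linarith
      next
        case False
        then obtain x where x: "x \<in> X" "U x > 0" "z = D x / U x + max 0 (U x - r)"
          using z by (auto simp: A_def)
        have "Inf (A s) \<le> D x / U x + max 0 (U x - s)"
          using x by (intro cInf_lower[OF _ bdd]) (auto simp: A_def)
        then show ?thesis unfolding x(3) max_def by (auto split: if_splits)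
      qed
    qed
    then show ?thesis by simp
  qed
  show ?thesis
  proof (rule that[of \<omega>])
    have "1-lipschitz_on UNIV \<omega>"
    proof (rule lipschitz_onI)
      fix x y :: real
      show "dist (\<omega> x) (\<omega> y) \<le> 1 * dist x y"
        using lip[of x y] lip[of y x] abs_minus_commute[of x y] by (simp add: dist_real_def)
    qed simp
    then show "continuous_on UNIV \<omega>" by (rule lipschitz_on_continuous_on)
    show "antimono \<omega>"
    proof (rule antimonoI)
      fix r s :: real assume "r \<le> s"
      show "\<omega> s \<le> \<omega> r"
        unfolding \<omega>_def
      proof (rule cInf_mono[OF ne bdd])
        fix z assume z: "z \<in> A r"
        show "\<exists>a\<in>A s. a \<le> z"
        proof (cases "z = 1")
          case False
          then obtain x where x: "x \<in> X" "U x > 0" "z = D x / U x + max 0 (U x - r)"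
            using z by (auto simp: A_def)
          then show ?thesis using \<open>r \<le> s\<close>
            by (intro bexI[of _ "D x / U x + max 0 (U x - s)"]) (auto simp: A_def)
        qed (auto simp: A_def)
      qed
    qed
    fix r
    \<comment> \<open>Points above the level \<open>r + 1\<close> pay a penalty of at least \<open>1\<close>; for the others the given rate applies.\<close>
    obtain w where w: "w > 0" "\<And>x. x \<in> X \<Longrightarrow> U x \<le> r + 1 \<Longrightarrow> w * U x \<le> D x"
      using assms[of "r + 1"] by blast
    have "min w 1 \<le> \<omega> r"
      unfolding \<omega>_def
    proof (rule cInf_greatest[OF ne])
      fix z assume z: "z \<in> A r"
      show "min w 1 \<le> z"
      proof (cases "z = 1")
        case False
        then obtain x where x: "x \<in> X" "U x > 0" "z = D x / U x + max 0 (U x - r)"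
          using z by (auto simp: A_def)
        show ?thesis
        proof (cases "U x \<le> r + 1")
          case True
          then have "w \<le> D x / U x" using w(2)[OF x(1)] x(2) by (simp add: pos_le_divide_eq)
          then show ?thesis unfolding x(3) by linarith
        next
          case False
          have "0 \<le> D x / U x" using D0 x by simp
          then show ?thesis using False unfolding x(3) by linarith
        qed
      qed simp
    qed
    then show "\<omega> r > 0" using w(1) by linarith
  next
    fix x r assume x: "x \<in> X" "0 \<le> U x" "U x \<le> r"
    show "\<omega> r * U x \<le> D x"
    proof (cases "U x = 0")
      case True
      then show ?thesis using assms[of 0] x(1) by auto
    next
      case False
      then have U: "U x > 0" using x by simp
      have "\<omega> r \<le> D x / U x + max 0 (U x - r)"
        unfolding \<omega>_def by (rule cInf_lower[OF _ bdd]) (use x(1) U in \<open>unfold A_def, blast\<close>)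
      also have "\<dots> = D x / U x" using x by simp
      finally show ?thesis using U by (simp add: pos_le_divide_eq)
    qed
  qed
qed

lemma class_KL_exponential:
  assumes "continuous_on UNIV \<omega>" and "antimono \<omega>" and "\<And>r. \<omega> r > 0"
  shows "class_KL (\<lambda>s t. s * exp (- \<omega> s * t))"
  unfolding class_KL_def
proof (intro conjI allI impI)
  have [continuous_intros]: "continuous_on S (\<lambda>x. \<omega> (fst x))" for S :: "(real \<times> real) set"
    by (rule continuous_on_compose2[OF assms(1)]) (auto intro!: continuous_intros)
  show "continuous_on ({0..} \<times> {0..}) (\<lambda>(s, t). s * exp (- \<omega> s * t))"
    unfolding case_prod_unfold by (intro continuous_intros)
next
  fix t :: real assume "0 \<le> t"
  show "class_K (\<lambda>s. s * exp (- \<omega> s * t))"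
    unfolding class_K_def
  proof (intro conjI)
    have [continuous_intros]: "continuous_on {0..} \<omega>"
      using assms(1) continuous_on_subset by blast
    show "continuous_on {0..} (\<lambda>s. s * exp (- \<omega> s * t))" by (intro continuous_intros)
    show "strict_mono_on {0..} (\<lambda>s. s * exp (- \<omega> s * t))"
    proof (rule strict_mono_onI)
      fix r s :: real assume rs: "r \<in> {0..}" "s \<in> {0..}" "r < s"
      have "\<omega> s * t \<le> \<omega> r * t"
        using rs \<open>0 \<le> t\<close> antimonoD[OF assms(2), of r s] by (intro mult_right_mono) auto
      then have "r * exp (- \<omega> r * t) \<le> r * exp (- \<omega> s * t)"
        using rs by (intro mult_left_mono) auto
      also have "\<dots> < s * exp (- \<omega> s * t)" using rs by simp
      finally show "r * exp (- \<omega> r * t) < s * exp (- \<omega> s * t)" .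
    qed
  qed auto
next
  fix s :: real assume s: "0 \<le> s"
  show "antimono_on {0..} (\<lambda>t. s * exp (- \<omega> s * t))"
    using s assms(3)[of s] by (intro monotone_onI) (auto intro!: mult_left_mono)
  have "((\<lambda>t. s * exp (- (\<omega> s * t))) \<longlongrightarrow> s * 0) at_top"
    using assms(3)[of s]
    by (intro tendsto_mult_left filterlim_compose[OF exp_at_bot] filterlim_compose[OF filterlim_uminus_at_bot_at_top]
        filterlim_tendsto_pos_mult_at_top[OF tendsto_const _ filterlim_ident])
  then show "((\<lambda>t. s * exp (- \<omega> s * t)) \<longlongrightarrow> 0) at_top" by simp
qed

lemma class_K_inf_square:
  assumes "c > 0"
  shows "class_K_inf (\<lambda>d. c * d\<^sup>2)"
  unfolding class_K_inf_def class_K_def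
proof (intro conjI)
  show "filterlim (\<lambda>d. c * d\<^sup>2) at_top at_top"
    using assms by (intro filterlim_tendsto_pos_mult_at_top[OF tendsto_const] filterlim_pow_at_top filterlim_ident) auto
  show "strict_mono_on {0..} (\<lambda>d. c * d\<^sup>2)"
    using assms by (intro strict_mono_onI) (auto intro!: power_strict_mono)
qed (use assms in \<open>auto intro!: continuous_intros\<close>)

section \<open>Finite sums around the ring\<close>

lemma sum_cyclic_shift:
  fixes h :: "nat \<Rightarrow> 'a::comm_monoid_add"
  assumes "h n = h 0"
  shows "(\<Sum>i=1..n. h (i - 1)) = (\<Sum>i=1..n. h i)"
proof (cases n)
  case (Suc m)
  have "(\<Sum>i=1..n. h (i - 1)) = (\<Sum>i\<le>m. h i)"
    unfolding Suc by (simp add: sum.atLeast1_atMost_eq flip: lessThan_Suc_atMost)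
  also have "\<dots> = h n + (\<Sum>i<m. h (Suc i))"
    using sum.atMost_shift[of h m] assms by simp
  also have "\<dots> = (\<Sum>i=1..n. h i)"
    unfolding Suc by (simp add: sum.atLeast1_atMost_eq add.commute)
  finally show ?thesis .
qed simp

text \<open>All pairwise differences of values on the ring are controlled by the differences of neighbours.\<close>

lemma abs_diff_le_sum_increments:
  fixes A :: "nat \<Rightarrow> real"
  assumes "j \<in> {1..n}" "k \<in> {1..n}"
  shows "\<bar>A j - A k\<bar> \<le> (\<Sum>i=1..n. \<bar>A (i + 1) - A i\<bar>)"
proof -
  have *: "\<bar>A j - A k\<bar> \<le> (\<Sum>i=1..n. \<bar>A (i + 1) - A i\<bar>)" if "1 \<le> k" "k \<le> j" "j \<le> n" for j k
  proof -
    have "\<bar>A j - A k\<bar> = \<bar>\<Sum>i=k..<j. A (Suc i) - A i\<bar>"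
      using that by (simp add: sum_Suc_diff')
    also have "\<dots> \<le> (\<Sum>i=k..<j. \<bar>A (Suc i) - A i\<bar>)" by (rule sum_abs)
    also have "\<dots> \<le> (\<Sum>i=1..n. \<bar>A (Suc i) - A i\<bar>)"
      using that by (intro sum_mono2) auto
    finally show ?thesis by simp
  qed
  show ?thesis
    using *[of j k] *[of k j] assms by (cases "k \<le> j") (auto simp: abs_minus_commute)
qed

section \<open>Coordinates of a state and the speed feedback\<close>

text \<open>Spacings and speeds are addressed by one countable index type, so that facts about the system as a
vector field are stated once for both.\<close>

definition coord :: "nat + nat \<Rightarrow> state \<Rightarrow> real" where
  "coord k x = (case k of Inl i \<Rightarrow> fst x i | Inr i \<Rightarrow> snd x i)"

definition of_coords :: "(nat + nat \<Rightarrow> real) \<Rightarrow> state" where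
  "of_coords z = (\<lambda>i. z (Inl i), \<lambda>i. z (Inr i))"

lemma coord_of_coords [simp]: "coord k (of_coords z) = z k"
  by (simp add: coord_def of_coords_def split: sum.split)

lemma of_coords_coord [simp]: "of_coords (\<lambda>k. coord k x) = x"
  by (simp add: coord_def of_coords_def)

lemma continuous_on_coord: "continuous_on S (coord k)"
proof -
  have "continuous_on S (\<lambda>x. fst x i)" "continuous_on S (\<lambda>x. snd x i)" for i and S :: "state set"
    by (rule continuous_on_product_then_coordinatewise, rule continuous_on_fst continuous_on_snd,
        rule continuous_on_id)+
  then show ?thesis unfolding coord_def by (cases k) simp_all
qed

lemma continuous_on_of_coords:
  assumes "\<And>k. continuous_on S (\<lambda>x. h x k)"
  shows "continuous_on S (\<lambda>x. of_coords (h x))"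
  unfolding of_coords_def using assms
  by (intro continuous_on_Pair continuous_on_coordinatewise_then_product)

lemma beta_pos:
  assumes "0 < w" "w < m" "0 < y" "y < m"
  shows "0 < beta m w y"
proof -
  have "m ^ 3 * (w + y) - 2 * m\<^sup>2 * y * w = m\<^sup>2 * (w * (m - y) + y * (m - w))"
    by (simp add: algebra_simps power2_eq_square power3_eq_cube)
  moreover have "0 < m\<^sup>2 * (w * (m - y) + y * (m - w))"
    using assms by (intro mult_pos_pos add_pos_pos) auto
  ultimately show ?thesis using assms unfolding beta_def by simp
qed

text \<open>This is where the form of \<open>beta\<close> comes from: differentiation yields
\<open>(p - q) * (beta m p q * p' - m\<^sup>2 * q' / (p * (m - p)))\<close>, and the feedback law for \<open>p'\<close> cancels both
\<open>beta\<close> and the term with \<open>q'\<close>.\<close>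

lemma kinetic_term_derivative:
  fixes p q :: "real \<Rightarrow> real"
  assumes p: "(p has_real_derivative p') (at t within J)" and q: "(q has_real_derivative q') (at t within J)"
    and pt: "0 < p t" "p t < m" and qt: "0 < q t" "q t < m"
    and p': "p' = 1 / beta m (p t) (q t) * ((m\<^sup>2 * q' - \<mu> * m\<^sup>2 * (p t - q t)) / (p t * (m - p t)) + A)"
  shows "((\<lambda>\<tau>. m\<^sup>2 / 2 * ((p \<tau> - q \<tau>)\<^sup>2 / (p \<tau> * (m - p \<tau>)))) has_real_derivative
     - \<mu> * m\<^sup>2 * ((p t - q t)\<^sup>2 / (p t * (m - p t))) + (p t - q t) * A) (at t within J)"
proof -
  let ?P = "p t" and ?Q = "q t"
  define w where "w = ?P * (m - ?P)"
  have w: "w \<noteq> 0" using pt by (simp add: w_def)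
  have "beta m ?P ?Q \<noteq> 0" using beta_pos[OF pt qt] by simp
  then have bp: "beta m ?P ?Q * p' = (m\<^sup>2 * q' - \<mu> * m\<^sup>2 * (?P - ?Q)) / w + A"
    unfolding p' w_def by simp
  have beta: "beta m ?P ?Q = m\<^sup>2 * (m * (?P + ?Q) - 2 * ?P * ?Q) / (2 * w\<^sup>2)"
    unfolding beta_def w_def by (simp add: algebra_simps power2_eq_square power3_eq_cube)
  have D: "((\<lambda>\<tau>. m\<^sup>2 / 2 * ((p \<tau> - q \<tau>)\<^sup>2 / (p \<tau> * (m - p \<tau>)))) has_real_derivative
     m\<^sup>2 / 2 * ((2 * (?P - ?Q) * (p' - q') * w - (?P - ?Q)\<^sup>2 * (p' * (m - ?P) - ?P * p')) / (w * w))) (at t within J)"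
  proof (intro DERIV_cmult)
    have num: "((\<lambda>\<tau>. (p \<tau> - q \<tau>)\<^sup>2) has_real_derivative 2 * (?P - ?Q) * (p' - q')) (at t within J)"
      by (auto intro!: derivative_eq_intros p q)
    have den: "((\<lambda>\<tau>. p \<tau> * (m - p \<tau>)) has_real_derivative p' * (m - ?P) - ?P * p') (at t within J)"
      by (auto intro!: derivative_eq_intros p q simp: algebra_simps)
    show "((\<lambda>\<tau>. (p \<tau> - q \<tau>)\<^sup>2 / (p \<tau> * (m - p \<tau>))) has_real_derivative
       (2 * (?P - ?Q) * (p' - q') * w - (?P - ?Q)\<^sup>2 * (p' * (m - ?P) - ?P * p')) / (w * w)) (at t within J)"
      using DERIV_divide[OF num den] w unfolding w_def by simp
  qed
  have "m\<^sup>2 / 2 * ((2 * (?P - ?Q) * (p' - q') * w - (?P - ?Q)\<^sup>2 * (p' * (m - ?P) - ?P * p')) / (w * w))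
     = (?P - ?Q) * (beta m ?P ?Q * p' - m\<^sup>2 * q' / w)"
  proof -
    have eq: "2 * (?P - ?Q) * (p' - q') * w - (?P - ?Q)\<^sup>2 * (p' * (m - ?P) - ?P * p')
       = (?P - ?Q) * ((m * (?P + ?Q) - 2 * ?P * ?Q) * p' - 2 * q' * w)"
      unfolding w_def by (simp add: algebra_simps power2_eq_square)
    show ?thesis unfolding eq beta using w by (simp add: field_simps power2_eq_square)
  qed
  also have "\<dots> = - \<mu> * m\<^sup>2 * ((?P - ?Q)\<^sup>2 / w) + (?P - ?Q) * A"
    unfolding bp using w by (simp add: field_simps power2_eq_square)
  finally show ?thesis using D unfolding w_def by (simp only:)
qed

section \<open>Potential, control law and headways\<close>

locale ring_road =
  fixes n :: nat and R L lam vmax vstar \<mu> :: real and V b :: "real \<Rightarrow> real"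
  assumes n_ge: "n \<ge> 2" and R_pos: "R > 0" and L_pos: "0 < L" and L_less: "L < R / real n"
    and vmax_pos: "vmax > 0" and vstar_pos: "0 < vstar" and vstar_less: "vstar < vmax" and \<mu>_pos: "\<mu> > 0"
    and V_C3: "C_diff_on 3 V {L<..}"
    and V_nonneg: "\<And>x. x > L \<Longrightarrow> V x \<ge> 0"
    and V_lim: "filterlim V at_top (at_right L)"
    and V_zero: "\<And>x. x \<ge> lam \<Longrightarrow> V x = 0"
    and V_deriv: "\<And>x. L < x \<Longrightarrow> x < lam \<Longrightarrow> deriv V x < 0"
    and V_deriv2: "\<And>x. L < x \<Longrightarrow> x < lam \<Longrightarrow> deriv (deriv V) x > 0"
    and b_C2: "C_diff_on 2 b UNIV"
    and b_range: "\<And>x. vstar - vmax < b x \<and> b x < vstar"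
    and b_mono: "strict_mono b"
    and b_0: "b 0 = 0"
    and b_sgn: "\<And>x. x \<noteq> 0 \<Longrightarrow> x * b x > 0"
    and b_deriv: "deriv b 0 > 0"
    and R_less: "R < real n * lam"
begin

abbreviation V1 :: "real \<Rightarrow> real" where "V1 \<equiv> deriv V"
abbreviation V2 :: "real \<Rightarrow> real" where "V2 \<equiv> deriv (deriv V)"
abbreviation rho :: real where "rho \<equiv> R / real n"
abbreviation Om :: "state set" where "Om \<equiv> Omega n R L vmax"
abbreviation gp :: "(nat \<Rightarrow> real) \<Rightarrow> nat \<Rightarrow> real" where "gp \<equiv> gap n R"
abbreviation sp :: "(nat \<Rightarrow> real) \<Rightarrow> nat \<Rightarrow> real" where "sp \<equiv> speed n"
abbreviation f :: "nat \<Rightarrow> (nat \<Rightarrow> real) \<Rightarrow> real" where "f \<equiv> f_ring n R vstar V b"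
abbreviation U :: "state \<Rightarrow> real" where "U \<equiv> U_ring n R vmax vstar V b"
abbreviation eqm :: state where "eqm \<equiv> equilibrium n R vstar"
abbreviation dV :: "nat \<Rightarrow> (nat \<Rightarrow> real) \<Rightarrow> real"
  where "dV i s \<equiv> V1 (gp s (i + 1)) - V1 (gp s i)"

text \<open>The weight \<open>1 / (v (vmax - v))\<close> blows up at both ends of the admissible speed range.\<close>

definition kinetic :: "state \<Rightarrow> real" where
  "kinetic x = (\<Sum>i=1..n. (snd x i - f i (fst x))\<^sup>2 / (snd x i * (vmax - snd x i)))"

text \<open>The excess over the potential of equal spacings.\<close>

definition potential :: "state \<Rightarrow> real" where
  "potential x = (\<Sum>i=1..n. V (gp (fst x) i) - V rho)"

text \<open>The negative of the derivative of \<open>U\<close> along solutions, see \<open>U_derivative\<close>.\<close>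

definition dissipation :: "state \<Rightarrow> real" where
  "dissipation x = \<mu> * vmax\<^sup>2 * kinetic x + (\<Sum>i=1..n. dV i (fst x) * b (dV i (fst x)))"

lemma U_eq: "U x = vmax\<^sup>2 / 2 * kinetic x + potential x"
  by (simp add: U_ring_def H_ring_def kinetic_def potential_def case_prod_unfold sum_subtractf)

lemma V_derivs:
  assumes "L < x"
  shows "(V has_real_derivative V1 x) (at x)" and "(V1 has_real_derivative V2 x) (at x)"
proof -
  have "(deriv ^^ j) V field_differentiable at x" if "j < 3" for j
    using V_C3 assms that by (auto simp: C_diff_on_def)
  from this[of 0] this[of 1] show "(V has_real_derivative V1 x) (at x)" "(V1 has_real_derivative V2 x) (at x)"
    by (simp_all add: DERIV_deriv_iff_field_differentiable)
qed

lemma V_continuous [continuous_intros]: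
  "continuous_on {L<..} V" "continuous_on {L<..} V1" "continuous_on {L<..} V2"
proof -
  have "(deriv ^^ j) V field_differentiable at x" if "j < 3" "L < x" for j x
    using V_C3 that by (auto simp: C_diff_on_def)
  then have c: "continuous_on {L<..} ((deriv ^^ j) V)" if "j < 3" for j
    using that by (auto intro!: continuous_at_imp_continuous_on field_differentiable_imp_continuous_at)
  from c[of 0] c[of 1] c[of 2]
  show "continuous_on {L<..} V" "continuous_on {L<..} V1" "continuous_on {L<..} V2"
    by (simp_all add: numeral_2_eq_2)
qed

lemma b_derivative: "(b has_real_derivative deriv b x) (at x)"
  and b_continuous: "continuous_on UNIV b" "continuous_on UNIV (deriv b)"
proof -
  have d: "(deriv ^^ j) b field_differentiable at x" if "j < 2" for j x
    using b_C2 that by (auto simp: C_diff_on_def)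
  from d[of 0 x] show "(b has_real_derivative deriv b x) (at x)"
    by (simp add: DERIV_deriv_iff_field_differentiable)
  have c: "continuous_on UNIV ((deriv ^^ j) b)" if "j < 2" for j
    using d that by (auto intro!: continuous_at_imp_continuous_on field_differentiable_imp_continuous_at)
  from c[of 0] c[of 1] show "continuous_on UNIV b" "continuous_on UNIV (deriv b)"
    by simp_all
qed

lemma b_abs_le: "\<bar>b x\<bar> \<le> vmax"
  using b_range[of x] vstar_pos vstar_less by (simp add: abs_le_iff)

lemma f_bounds: "0 < f i s" "f i s < vmax"
  using b_range[of "dV i s"] by (simp_all add: f_ring_def)

lemma rho_bounds: "L < rho" "rho < lam" "rho < R"
  using n_ge L_less R_less R_pos by (simp_all add: field_simps)

text \<open>At \<open>lam\<close> itself the value follows from continuity of the derivative.\<close>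

lemma V1_eq_0:
  assumes "lam \<le> x"
  shows "V1 x = 0"
proof -
  have *: "V1 x = 0" if "lam < x" for x
  proof -
    have "((\<lambda>_. 0) has_real_derivative 0) (at x)" by simp
    then have "(V has_real_derivative 0) (at x)"
      by (rule has_field_derivative_transform_within_open[where S = "{lam<..}"])
         (use that V_zero in auto)
    then show ?thesis by (rule DERIV_imp_deriv)
  qed
  have "L < lam" using rho_bounds by linarith
  then have "isCont V1 lam" using V_derivs(2) DERIV_isCont by blast
  then have "(V1 \<longlongrightarrow> V1 lam) (at_right lam)"
    by (simp add: isCont_def filterlim_at_split)
  moreover have "(V1 \<longlongrightarrow> 0) (at_right lam)"
    by (rule tendsto_eventually) (auto simp: eventually_at_filter * intro!: always_eventually)
  ultimately have "V1 lam = 0"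
    by (rule tendsto_unique[rotated]) simp
  then show ?thesis using * assms by (cases "x = lam") auto
qed

lemma V1_nonpos: "L < x \<Longrightarrow> V1 x \<le> 0"
  using V_deriv[of x] V1_eq_0[of x] by (cases "x < lam") auto

lemma V1_mono: "mono_on {L<..} V1"
proof (rule mono_onI)
  fix x y assume xy: "x \<in> {L<..}" "y \<in> {L<..}" "x \<le> y"
  show "V1 x \<le> V1 y"
  proof (cases "y < lam")
    case True
    show ?thesis
    proof (rule DERIV_nonneg_imp_nondecreasing[OF \<open>x \<le> y\<close>])
      fix z assume "x \<le> z" "z \<le> y"
      then have z: "L < z" "z < lam" using xy True by auto
      then show "\<exists>d. (V1 has_real_derivative d) (at z) \<and> 0 \<le> d"
        using V_derivs(2)[OF z(1)] V_deriv2[OF z] by (auto intro: less_imp_le)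
    qed
  next
    case False
    then show ?thesis using V1_eq_0[of y] V1_nonpos[of x] xy by simp
  qed
qed

text \<open>The mean spacing lies in the region where \<open>V'' > 0\<close>, so \<open>V'\<close> grows at least linearly around it,
uniformly over all spacings that can occur.\<close>

lemma V1_growth: "\<exists>c>0. \<forall>x\<in>{L<..<R}. c * \<bar>x - rho\<bar> \<le> \<bar>V1 x - V1 rho\<bar>"
  using rho_bounds
  by (intro monotone_growth_at_point[where l = "V2 rho"] V_derivs V_deriv2 mono_on_subset[OF V1_mono]) auto

lemma sum_gap: "(\<Sum>i=1..n. gp s i) = R"
proof -
  have "(\<Sum>i=1..n. gp s i) = gp s 1 + (\<Sum>i=2..n. gp s i)"
    using n_ge by (subst sum.atLeast_Suc_atMost) (auto simp: numeral_2_eq_2)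
  also have "(\<Sum>i=2..n. gp s i) = (\<Sum>i=2..n. s i)"
    by (rule sum.cong) (auto simp: gap_def)
  finally show ?thesis by (simp add: gap_def)
qed

lemma gap_last: "gp s (n + 1) = gp s 1"
  by (simp add: gap_def)

lemma gap_gt:
  assumes "x \<in> Om"
  shows "L < gp (fst x) i"
  using assms by (auto simp: Omega_def gap_def)

lemma gap_less:
  assumes "x \<in> Om"
  shows "gp (fst x) i < R"
proof -
  have *: "gp (fst x) i < R" if "i \<in> {1..n}" for i
  proof -
    obtain j where j: "j \<in> {1..n} - {i}"
      using n_ge that by (metis Diff_iff atLeastAtMost_iff insertE le_refl numeral_2_eq_2 one_le_numeral order.trans singletonD Suc_n_not_le_n One_nat_def)
    have pos: "0 < gp (fst x) k" for k using gap_gt[OF assms, of k] L_pos by linarith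
    have "0 < (\<Sum>k\<in>{1..n} - {i}. gp (fst x) k)"
      using j pos by (intro sum_pos) auto
    moreover have "(\<Sum>k=1..n. gp (fst x) k) = gp (fst x) i + (\<Sum>k\<in>{1..n} - {i}. gp (fst x) k)"
      using that by (simp add: sum.remove)
    ultimately show ?thesis using sum_gap[of "fst x"] by linarith
  qed
  show ?thesis using *[of i] *[of 1] n_ge by (cases "i \<in> {1..n}") (auto simp: gap_def)
qed

lemma speed_bounds:
  assumes "x \<in> Om" "i \<in> {1..n}"
  shows "0 < snd x i" "snd x i < vmax" "0 < snd x i * (vmax - snd x i)"
  using assms by (auto simp: Omega_def)

lemma sum_gap_dev: "(\<Sum>i=1..n. gp s i - rho) = 0"
  using n_ge sum_gap[of s] by (simp add: sum_subtractf)

section \<open>Two-sided energy estimates\<close>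

text \<open>Strong convexity at \<open>rho\<close>, summed over the ring: the linear terms cancel since the spacings have
mean \<open>rho\<close>.\<close>

lemma potential_lower:
  assumes c: "0 < c" "\<And>x. x \<in> {L<..<R} \<Longrightarrow> c * \<bar>x - rho\<bar> \<le> \<bar>V1 x - V1 rho\<bar>" and x: "x \<in> Om"
  shows "c/2 * (\<Sum>i=1..n. (gp (fst x) i - rho)\<^sup>2) \<le> potential x"
proof -
  have "V rho + V1 rho * (gp (fst x) i - rho) + c/2 * (gp (fst x) i - rho)\<^sup>2 \<le> V (gp (fst x) i)" for i
    using rho_bounds gap_gt[OF x] gap_less[OF x]
    by (intro strong_convexity_at_point[where a = L and b = R] V_derivs c mono_on_subset[OF V1_mono]) auto
  then have "(\<Sum>i=1..n. V1 rho * (gp (fst x) i - rho) + c/2 * (gp (fst x) i - rho)\<^sup>2) \<le> potential x"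
    unfolding potential_def by (intro sum_mono) (simp add: algebra_simps)
  moreover have "(\<Sum>i=1..n. V1 rho * (gp (fst x) i - rho) + c/2 * (gp (fst x) i - rho)\<^sup>2)
     = V1 rho * (\<Sum>i=1..n. gp (fst x) i - rho) + c/2 * (\<Sum>i=1..n. (gp (fst x) i - rho)\<^sup>2)"
    by (simp add: sum.distrib sum_distrib_left)
  ultimately show ?thesis by (simp only: sum_gap_dev mult_zero_right add_0_left)
qed

text \<open>Convexity bounds each summand, up to its linear part, by
\<open>(V'(s\<^sub>i) - V'(rho)) * (s\<^sub>i - rho)\<close>. As the spacings have mean \<open>rho\<close>, some spacing lies on the other
side of \<open>rho\<close> from \<open>s\<^sub>i\<close>, so monotonicity of \<open>V'\<close> bounds the first factor by the differences of \<open>V'\<close>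
around the ring. The second factor is bounded by the first one because \<open>V'\<close> grows linearly at
\<open>rho\<close>.\<close>

lemma potential_upper:
  assumes c: "0 < c" "\<And>x. x \<in> {L<..<R} \<Longrightarrow> c * \<bar>x - rho\<bar> \<le> \<bar>V1 x - V1 rho\<bar>" and x: "x \<in> Om"
  shows "potential x \<le> (real n)\<^sup>2 / c * (\<Sum>i=1..n. (dV i (fst x))\<^sup>2)"
proof -
  let ?g = "gp (fst x)"
  define S where "S = (\<Sum>i=1..n. \<bar>dV i (fst x)\<bar>)"
  have range: "?g i \<in> {L<..<R}" for i using gap_gt[OF x] gap_less[OF x] by auto
  have dev: "\<bar>V1 (?g i) - V1 rho\<bar> \<le> S" if i: "i \<in> {1..n}" for i
  proof -
    have diff: "\<bar>V1 (?g i) - V1 (?g j)\<bar> \<le> S" if "j \<in> {1..n}" for j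
      unfolding S_def using abs_diff_le_sum_increments[OF i that, of "\<lambda>i. V1 (?g i)"] by simp
    have ne: "{1..n} \<noteq> {}" using n_ge by simp
    show ?thesis
    proof (cases "rho \<le> ?g i")
      case True
      have "\<exists>j\<in>{1..n}. ?g j \<le> rho"
      proof (rule ccontr)
        assume "\<not> ?thesis"
        then have "\<And>i. i \<in> {1..n} \<Longrightarrow> 0 < ?g i - rho" by (simp add: not_le)
        then have "0 < (\<Sum>i=1..n. ?g i - rho)" using ne by (intro sum_pos) simp_all
        then show False by (simp only: sum_gap_dev less_irrefl)
      qed
      then obtain j where j: "j \<in> {1..n}" "?g j \<le> rho" by blast
      have "V1 (?g j) \<le> V1 rho" "V1 rho \<le> V1 (?g i)"
        using j True range rho_bounds by (auto intro!: mono_onD[OF V1_mono])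
      then show ?thesis using diff[OF j(1)] by linarith
    next
      case False
      have "\<exists>j\<in>{1..n}. rho \<le> ?g j"
      proof (rule ccontr)
        assume "\<not> ?thesis"
        then have "\<And>i. i \<in> {1..n} \<Longrightarrow> 0 < - (?g i - rho)" by (simp add: not_le)
        then have "0 < (\<Sum>i=1..n. - (?g i - rho))" using ne by (intro sum_pos) simp_all
        also have "\<dots> = 0" using sum_gap_dev[of "fst x"] by (simp only: sum_negf)
        finally show False by simp
      qed
      then obtain j where j: "j \<in> {1..n}" "rho \<le> ?g j" by blast
      have "V1 rho \<le> V1 (?g j)" "V1 (?g i) \<le> V1 rho"
        using j False range rho_bounds by (auto intro!: mono_onD[OF V1_mono])
      then show ?thesis using diff[OF j(1)] by linarith
    qed
  qed
  have S0: "0 \<le> S" by (simp add: S_def sum_nonneg)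
  have summand: "V (?g i) - V rho - V1 rho * (?g i - rho) \<le> S\<^sup>2 / c" if i: "i \<in> {1..n}" for i
  proof -
    have "V (?g i) + V1 (?g i) * (rho - ?g i) + 0/2 * (rho - ?g i)\<^sup>2 \<le> V rho"
      using rho_bounds range
      by (intro strong_convexity_at_point[where a = L and b = R] V_derivs mono_on_subset[OF V1_mono]) auto
    then have "V (?g i) - V rho - V1 rho * (?g i - rho) \<le> (V1 (?g i) - V1 rho) * (?g i - rho)"
      by (simp add: algebra_simps)
    also have "\<dots> \<le> \<bar>V1 (?g i) - V1 rho\<bar> * \<bar>?g i - rho\<bar>"
      by (metis abs_ge_self abs_mult)
    also have "\<dots> \<le> S * (S / c)"
    proof (rule mult_mono)
      have "c * \<bar>?g i - rho\<bar> \<le> S" using c(2)[OF range] dev[OF i] by (rule order.trans)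
      then show "\<bar>?g i - rho\<bar> \<le> S / c" using c(1) by (simp add: field_simps)
    qed (use dev[OF i] S0 in auto)
    finally show ?thesis by (simp add: power2_eq_square)
  qed
  have "potential x = (\<Sum>i=1..n. V (?g i) - V rho - V1 rho * (?g i - rho)) + V1 rho * (\<Sum>i=1..n. ?g i - rho)"
    unfolding potential_def sum_distrib_left sum.distrib[symmetric] by simp
  also have "\<dots> = (\<Sum>i=1..n. V (?g i) - V rho - V1 rho * (?g i - rho))"
    by (simp only: sum_gap_dev mult_zero_right add_0_right)
  also have "\<dots> \<le> (\<Sum>i=1..n. S\<^sup>2 / c)" by (intro sum_mono summand)
  also have "\<dots> = real n / c * S\<^sup>2" by simp
  also have "\<dots> \<le> real n / c * ((\<Sum>i=1..n. (dV i (fst x))\<^sup>2) * real n)"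
    using sum_squared_le_sum_of_squares[of "\<lambda>i. \<bar>dV i (fst x)\<bar>" "{1..n}"] c(1)
    by (intro mult_left_mono) (simp_all add: S_def)
  finally show ?thesis by (simp add: power2_eq_square mult_ac)
qed

lemma kinetic_nonneg: "x \<in> Om \<Longrightarrow> 0 \<le> kinetic x"
  unfolding kinetic_def using speed_bounds by (intro sum_nonneg divide_nonneg_pos) auto

lemma potential_nonneg:
  assumes "x \<in> Om"
  shows "0 \<le> potential x"
proof -
  obtain c where c: "c > 0" "\<forall>x\<in>{L<..<R}. c * \<bar>x - rho\<bar> \<le> \<bar>V1 x - V1 rho\<bar>"
    using V1_growth by blast
  have "0 \<le> c/2 * (\<Sum>i=1..n. (gp (fst x) i - rho)\<^sup>2)"
    using c(1) by (intro mult_nonneg_nonneg sum_nonneg) auto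
  also have "\<dots> \<le> potential x" using c assms by (intro potential_lower) auto
  finally show ?thesis .
qed

lemma U_nonneg: "x \<in> Om \<Longrightarrow> 0 \<le> U x"
  unfolding U_eq using kinetic_nonneg potential_nonneg by simp

lemma mult_b_nonneg: "0 \<le> z * b z"
  using b_sgn[of z] by (cases "z = 0") auto

lemma dissipation_nonneg: "x \<in> Om \<Longrightarrow> 0 \<le> dissipation x"
  unfolding dissipation_def using kinetic_nonneg mult_b_nonneg \<mu>_pos
  by (intro add_nonneg_nonneg sum_nonneg) simp_all

text \<open>The potential controls the spacings and the kinetic part controls the speed errors
\<open>v\<^sub>i - f\<^sub>i\<close>. The remaining part \<open>f\<^sub>i - vstar\<close> of the speed deviation is a value of \<open>b\<close> and is controlled
by the spacings again; boundedness of \<open>b\<close> makes this uniform up to the collision boundary.\<close>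

lemma U_quadratic_lower:
  "\<exists>c>0. \<forall>x\<in>Om. c * (state_dist n x eqm)\<^sup>2 \<le> U x"
proof -
  obtain c where c: "c > 0" "\<forall>x\<in>{L<..<R}. c * \<bar>x - rho\<bar> \<le> \<bar>V1 x - V1 rho\<bar>"
    using V1_growth by blast
  obtain C where C: "C > 0" "\<And>x y. \<bar>b (V1 x - V1 y)\<bar> \<le> C * (\<bar>x - rho\<bar> + \<bar>y - rho\<bar>)"
    using bounded_composition_linear_bound[OF V_derivs(2)[OF rho_bounds(1)] b_derivative b_0 b_abs_le] by blast
  define k where "k = 1 + (1 + 4 * C\<^sup>2 * 2) * (2 / c)"
  have k: "k > 0" using c by (simp add: k_def add_pos_nonneg)
  have "(state_dist n x eqm)\<^sup>2 \<le> k * U x" if x: "x \<in> Om" for x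
  proof -
    let ?g = "gp (fst x)"
    define Q where "Q = (\<Sum>i=1..n. (?g i - rho)\<^sup>2)"
    define E where "E = (\<Sum>i=1..n. (snd x i - f i (fst x))\<^sup>2)"
    have pot: "c/2 * Q \<le> potential x"
      unfolding Q_def using c x by (intro potential_lower) auto
    have "E \<le> vmax\<^sup>2 / 4 * kinetic x"
      unfolding E_def kinetic_def sum_distrib_left
    proof (rule sum_mono)
      fix i assume i: "i \<in> {1..n}"
      let ?w = "snd x i * (vmax - snd x i)" and ?e = "(snd x i - f i (fst x))\<^sup>2"
      have "?w \<le> vmax\<^sup>2 / 4"
        using zero_le_power2[of "vmax - 2 * snd x i"] by (simp add: power2_eq_square algebra_simps)
      then have "?e * ?w \<le> ?e * (vmax\<^sup>2 / 4)" by (intro mult_left_mono) auto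
      then show "?e \<le> vmax\<^sup>2 / 4 * (?e / ?w)"
        using speed_bounds(3)[OF x i] by (simp add: pos_le_divide_eq mult.commute)
    qed
    then have E: "2 * E \<le> vmax\<^sup>2 / 2 * kinetic x" by simp
    \<comment> \<open>Each spacing occurs once as \<open>i\<close> and once as \<open>i + 1\<close>.\<close>
    have shift: "(\<Sum>i=1..n. (?g (i + 1) - rho)\<^sup>2) = Q"
    proof -
      have "(\<Sum>i=1..n. (?g (i - 1 + 1) - rho)\<^sup>2) = (\<Sum>i=1..n. (?g (i + 1) - rho)\<^sup>2)"
        using sum_cyclic_shift[of "\<lambda>i. (?g (i + 1) - rho)\<^sup>2" n] gap_last[of "fst x"] by simp
      moreover have "(\<Sum>i=1..n. (?g (i - 1 + 1) - rho)\<^sup>2) = Q"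
        unfolding Q_def by (intro sum.cong) auto
      ultimately show ?thesis by simp
    qed
    have v: "(snd x i - vstar)\<^sup>2 \<le> 2 * (snd x i - f i (fst x))\<^sup>2
         + 4 * C\<^sup>2 * ((?g (i + 1) - rho)\<^sup>2 + (?g i - rho)\<^sup>2)" for i
    proof -
      let ?p = "?g (i + 1) - rho" and ?q = "?g i - rho" and ?e = "snd x i - f i (fst x)"
      have "(b (dV i (fst x)))\<^sup>2 \<le> (C * (\<bar>?p\<bar> + \<bar>?q\<bar>))\<^sup>2"
        using C(2)[of "?g (i + 1)" "?g i"] by (metis abs_ge_zero power2_abs power_mono)
      also have "\<dots> \<le> C\<^sup>2 * (2 * (?p\<^sup>2 + ?q\<^sup>2))"
      proof -
        have "(\<bar>p\<bar> + \<bar>q\<bar>)\<^sup>2 \<le> 2 * (p\<^sup>2 + q\<^sup>2)" for p q :: real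
          using zero_le_power2[of "\<bar>p\<bar> - \<bar>q\<bar>"] by (simp add: power2_sum power2_diff)
        then show ?thesis unfolding power_mult_distrib by (intro mult_left_mono) auto
      qed
      finally have "2 * (b (dV i (fst x)))\<^sup>2 \<le> 4 * C\<^sup>2 * (?p\<^sup>2 + ?q\<^sup>2)" by (simp add: algebra_simps)
      moreover have "(?e - b (dV i (fst x)))\<^sup>2 \<le> 2 * ?e\<^sup>2 + 2 * (b (dV i (fst x)))\<^sup>2"
      proof -
        have "(p - q)\<^sup>2 \<le> 2 * p\<^sup>2 + 2 * q\<^sup>2" for p q :: real
          using zero_le_power2[of "p + q"] by (simp add: power2_sum power2_diff)
        then show ?thesis .
      qed
      moreover have eq: "snd x i - vstar = ?e - b (dV i (fst x))"
        by (simp add: f_ring_def)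
      ultimately show ?thesis unfolding eq by linarith
    qed
    have "(state_dist n x eqm)\<^sup>2 = (\<Sum>i=2..n. (fst x i - rho)\<^sup>2) + (\<Sum>i=1..n. (snd x i - vstar)\<^sup>2)"
      by (simp add: state_dist_def equilibrium_def sum_nonneg)
    also have "(\<Sum>i=2..n. (fst x i - rho)\<^sup>2) = (\<Sum>i=2..n. (?g i - rho)\<^sup>2)"
      by (intro sum.cong) (auto simp: gap_def)
    also have "\<dots> \<le> Q" unfolding Q_def by (intro sum_mono2) auto
    also have "(\<Sum>i=1..n. (snd x i - vstar)\<^sup>2)
        \<le> (\<Sum>i=1..n. 2 * (snd x i - f i (fst x))\<^sup>2 + 4 * C\<^sup>2 * ((?g (i + 1) - rho)\<^sup>2 + (?g i - rho)\<^sup>2))"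
      by (intro sum_mono v)
    also have "\<dots> = 2 * E + 4 * C\<^sup>2 * (Q + Q)"
      using shift unfolding E_def by (simp add: sum.distrib Q_def flip: sum_distrib_left)
    finally have "(state_dist n x eqm)\<^sup>2 \<le> 2 * E + (1 + 4 * C\<^sup>2 * 2) * Q" by (simp add: algebra_simps)
    also have "\<dots> \<le> U x + (1 + 4 * C\<^sup>2 * 2) * (2 / c * U x)"
    proof (intro add_mono mult_left_mono)
      show "2 * E \<le> U x" using E potential_nonneg[OF x] by (simp add: U_eq)
      have "0 \<le> vmax\<^sup>2 / 2 * kinetic x" using kinetic_nonneg[OF x] by simp
      then have "c/2 * Q \<le> U x" unfolding U_eq using pot by linarith
      then show "Q \<le> 2 / c * U x" using c(1) by (simp add: field_simps)
    qed auto
    also have "\<dots> = k * U x" by (simp only: k_def distrib_right mult.assoc mult_1_left)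
    finally show ?thesis .
  qed
  then have "\<forall>x\<in>Om. 1/k * (state_dist n x eqm)\<^sup>2 \<le> U x"
    using k by (simp add: field_simps)
  then show ?thesis using k by (intro exI[of _ "1/k"]) simp
qed

text \<open>All summands of the potential energy are nonnegative, so a bound on \<open>U\<close> bounds \<open>V\<close> at each single
spacing, and \<open>V\<close> blows up at \<open>L\<close>.\<close>

lemma sublevel_gap: "\<exists>e>0. \<forall>x\<in>Om. U x \<le> r \<longrightarrow> (\<forall>i. L + e \<le> gp (fst x) i)"
proof -
  define M where "M = r + real n * V rho"
  have "\<forall>\<^sub>F z in at_right L. M < V z"
    using V_lim by (simp add: filterlim_at_top_dense)
  then obtain e where e: "L < e" "\<And>z. L < z \<Longrightarrow> z < e \<Longrightarrow> M < V z"
    by (auto simp: eventually_at_right_field)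
  have "e \<le> gp (fst x) i" if x: "x \<in> Om" "U x \<le> r" for x i
  proof -
    have *: "e \<le> gp (fst x) i" if i: "i \<in> {1..n}" for i
    proof (rule ccontr)
      assume "\<not> e \<le> gp (fst x) i"
      then have "M < V (gp (fst x) i)" using gap_gt[OF x(1), of i] by (intro e(2)) auto
      also have "\<dots> \<le> (\<Sum>i=1..n. V (gp (fst x) i))"
        using i gap_gt[OF x(1)] V_nonneg by (intro member_le_sum) auto
      also have "\<dots> = potential x + real n * V rho"
        by (simp add: potential_def sum_subtractf)
      also have "\<dots> \<le> U x + real n * V rho"
        using kinetic_nonneg[OF x(1)] by (simp add: U_eq)
      finally show False using x(2) by (simp add: M_def)
    qed
    show ?thesis using *[of i] *[of 1] n_ge by (cases "i \<in> {1..n}") (auto simp: gap_def)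
  qed
  then show ?thesis using e(1) by (intro exI[of _ "e - L"]) auto
qed

lemma dV_bound:
  assumes "x \<in> Om" "0 < e" "\<And>i. L + e \<le> gp (fst x) i"
  shows "\<bar>dV i (fst x)\<bar> \<le> - V1 (L + e)"
proof -
  have "V1 (L + e) \<le> V1 (gp (fst x) j)" "V1 (gp (fst x) j) \<le> 0" for j
    using assms gap_gt[OF assms(1), of j] by (auto intro!: mono_onD[OF V1_mono] V1_nonpos)
  from this[of i] this[of "i + 1"] show ?thesis by linarith
qed

text \<open>The kinetic parts of \<open>U\<close> and of the dissipation are proportional with factor \<open>2 * \<mu>\<close>. The potential
part is at most a multiple of the sum of squares of the \<open>dV i\<close>, which range over a bounded interval
on a sublevel set; there \<open>b\<close> grows linearly at \<open>0\<close>.\<close>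

lemma dissipation_rate: "\<exists>w>0. \<forall>x\<in>Om. U x \<le> r \<longrightarrow> w * U x \<le> dissipation x"
proof -
  obtain c where c: "c > 0" "\<forall>x\<in>{L<..<R}. c * \<bar>x - rho\<bar> \<le> \<bar>V1 x - V1 rho\<bar>"
    using V1_growth by blast
  obtain e where e: "e > 0" "\<And>x i. x \<in> Om \<Longrightarrow> U x \<le> r \<Longrightarrow> L + e \<le> gp (fst x) i"
    using sublevel_gap[of r] by blast
  \<comment> \<open>The summand \<open>1\<close> makes the interval of arguments of \<open>b\<close> open.\<close>
  define G where "G = 1 - V1 (L + e)"
  have G: "G > 0" using V1_nonpos[of "L + e"] e(1) by (simp add: G_def)
  have "\<exists>k>0. \<forall>z\<in>{-G<..<G}. k * \<bar>z - 0\<bar> \<le> \<bar>b z - b 0\<bar>"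
    using G by (intro monotone_growth_at_point[where l = "deriv b 0"] b_derivative b_deriv)
      (auto intro!: mono_onI simp: strict_mono_less_eq[OF b_mono])
  then obtain k where k: "k > 0" "\<And>z. z \<in> {-G<..<G} \<Longrightarrow> k * \<bar>z\<bar> \<le> \<bar>b z\<bar>"
    by (auto simp: b_0)
  define w where "w = min (2 * \<mu>) (k * (c / (real n)\<^sup>2))"
  have n0: "real n > 0" using n_ge by simp
  have w: "w > 0" "w \<le> 2 * \<mu>" "w \<le> k * (c / (real n)\<^sup>2)" using \<mu>_pos k(1) c(1) n0 by (simp_all add: w_def)
  have "w * U x \<le> dissipation x" if x: "x \<in> Om" "U x \<le> r" for x
  proof -
    let ?S = "\<Sum>i=1..n. (dV i (fst x))\<^sup>2"
    have "w * (vmax\<^sup>2 / 2 * kinetic x) \<le> 2 * \<mu> * (vmax\<^sup>2 / 2 * kinetic x)"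
      using w kinetic_nonneg[OF x(1)] by (intro mult_right_mono) auto
    moreover have "w * potential x \<le> k * (c / (real n)\<^sup>2) * potential x"
      using w potential_nonneg[OF x(1)] by (intro mult_right_mono) auto
    moreover have "k * (c / (real n)\<^sup>2) * potential x \<le> k * (c / (real n)\<^sup>2) * ((real n)\<^sup>2 / c * ?S)"
      using potential_upper[OF c(1) _ x(1)] c(2) k(1) c(1) by (intro mult_left_mono) auto
    moreover have "k * (c / (real n)\<^sup>2) * ((real n)\<^sup>2 / c * ?S) = k * ?S"
      using c(1) n0 by simp
    moreover have "k * ?S \<le> (\<Sum>i=1..n. dV i (fst x) * b (dV i (fst x)))"
      unfolding sum_distrib_left
    proof (rule sum_mono)
      fix i
      let ?z = "dV i (fst x)"
      have "\<bar>?z\<bar> < G" using dV_bound[OF x(1) e(1) e(2)[OF x], of i] by (simp add: G_def)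
      then have "k * \<bar>?z\<bar> \<le> \<bar>b ?z\<bar>" by (intro k(2)) auto
      then have "\<bar>?z\<bar> * (k * \<bar>?z\<bar>) \<le> \<bar>?z\<bar> * \<bar>b ?z\<bar>" by (intro mult_left_mono) auto
      also have "\<dots> = ?z * b ?z" using mult_b_nonneg[of ?z] by (simp flip: abs_mult)
      also have "\<bar>?z\<bar> * (k * \<bar>?z\<bar>) = k * ?z\<^sup>2"
        by (simp add: power2_eq_square)
      finally show "k * ?z\<^sup>2 \<le> ?z * b ?z" .
    qed
    ultimately show ?thesis unfolding U_eq dissipation_def distrib_left by simp
  qed
  then show ?thesis using w(1) by blast
qed

section \<open>Continuity and compact sublevel sets\<close>

lemma continuous_snd_coord: "continuous_on S (\<lambda>x::state. snd x i)"
  using continuous_on_coord[of S "Inr i"] by (simp add: coord_def)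

lemma continuous_gap: "continuous_on S (\<lambda>x::state. gp (fst x) i)"
proof -
  have "continuous_on S (\<lambda>x::state. fst x j)" for j
    using continuous_on_coord[of S "Inl j"] by (simp add: coord_def)
  then show ?thesis unfolding gap_def by (cases "i \<in> {2..n}") (auto intro!: continuous_intros)
qed

lemma continuous_speed: "continuous_on S (\<lambda>x::state. sp (snd x) i)"
  unfolding speed_def by (cases "i = 0"; cases "i = n + 1") (simp_all add: continuous_snd_coord)

lemma continuous_V_gap:
  "continuous_on Om (\<lambda>x. V (gp (fst x) i))"
  "continuous_on Om (\<lambda>x. V1 (gp (fst x) i))"
  "continuous_on Om (\<lambda>x. V2 (gp (fst x) i))"
  using gap_gt by (auto intro!: continuous_on_compose2[OF V_continuous(1) continuous_gap]
      continuous_on_compose2[OF V_continuous(2) continuous_gap]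
      continuous_on_compose2[OF V_continuous(3) continuous_gap])

lemma continuous_b_dV:
  "continuous_on Om (\<lambda>x. b (dV i (fst x)))"
  "continuous_on Om (\<lambda>x. deriv b (dV i (fst x)))"
  by (rule continuous_on_compose2[OF b_continuous(1)] continuous_on_compose2[OF b_continuous(2)];
      intro continuous_intros continuous_V_gap subset_UNIV)+

lemma continuous_f: "continuous_on Om (\<lambda>x. f i (fst x))"
  unfolding f_ring_def by (intro continuous_intros continuous_b_dV)

lemma continuous_U: "continuous_on Om U"
proof -
  have "snd x i \<noteq> 0 \<and> vmax - snd x i \<noteq> 0" if "x \<in> Om" "i \<in> {1..n}" for x i
    using speed_bounds[OF that] by simp
  then show ?thesis
    unfolding U_eq[abs_def] kinetic_def potential_def
    by (auto intro!: continuous_intros continuous_V_gap continuous_f continuous_snd_coord)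
qed

text \<open>On a sublevel set the \<open>dV i\<close> are bounded, so the target speeds \<open>f i\<close> stay at a distance \<open>\<phi>\<close> from \<open>0\<close>
and from \<open>vmax\<close>. A speed within \<open>\<phi>/2\<close> of the boundary then has an error of at least \<open>\<phi>/2\<close>, and the
bound on the weighted squared error keeps its weight bounded.\<close>

lemma sublevel_speed:
  "\<exists>d>0. \<forall>x\<in>Om. U x \<le> r \<longrightarrow> (\<forall>i\<in>{1..n}. d \<le> snd x i \<and> snd x i \<le> vmax - d)"
proof -
  obtain e where e: "e > 0" "\<And>x i. x \<in> Om \<Longrightarrow> U x \<le> r \<Longrightarrow> L + e \<le> gp (fst x) i"
    using sublevel_gap[of r] by blast
  define G where "G = - V1 (L + e)"
  define \<phi> where "\<phi> = min (vstar - b G) (vmax - vstar + b (- G))"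
  have \<phi>: "\<phi> > 0" using b_range[of G] b_range[of "- G"] by (simp add: \<phi>_def)
  define K where "K = 1 + 2 * \<bar>r\<bar> / vmax\<^sup>2"
  have K: "K > 0" using vmax_pos by (simp add: K_def add_pos_nonneg)
  define d where "d = min (\<phi>/2) (\<phi>\<^sup>2 / (4 * K * vmax))"
  have d: "d > 0" using \<phi> K vmax_pos by (simp add: d_def)
  have "d \<le> snd x i \<and> snd x i \<le> vmax - d" if x: "x \<in> Om" "U x \<le> r" and i: "i \<in> {1..n}" for x i
  proof -
    let ?v = "snd x i" and ?f = "f i (fst x)"
    have "\<bar>dV i (fst x)\<bar> \<le> G" unfolding G_def by (rule dV_bound[OF x(1) e(1) e(2)[OF x]])
    then have "b (- G) \<le> b (dV i (fst x))" "b (dV i (fst x)) \<le> b G"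
      by (auto simp: strict_mono_less_eq[OF b_mono] abs_le_iff)
    then have f: "\<phi> \<le> ?f" "?f \<le> vmax - \<phi>" by (auto simp: f_ring_def \<phi>_def)
    have v: "0 < ?v" "?v < vmax" "0 < ?v * (vmax - ?v)" using speed_bounds[OF x(1) i] by auto
    have "(?v - ?f)\<^sup>2 / (?v * (vmax - ?v)) \<le> kinetic x"
      unfolding kinetic_def
      by (rule member_le_sum[OF i]) (use speed_bounds(3)[OF x(1)] in \<open>auto intro!: divide_nonneg_pos\<close>)
    also have "vmax\<^sup>2 / 2 * kinetic x \<le> r" using x(2) potential_nonneg[OF x(1)] unfolding U_eq by linarith
    then have "kinetic x \<le> 2 * r / vmax\<^sup>2" using vmax_pos by (simp add: field_simps)
    also have "\<dots> \<le> K" unfolding K_def using vmax_pos by (intro order.trans[OF divide_right_mono[of "2 * r" "2 * \<bar>r\<bar>"]]) auto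
    finally have err: "(?v - ?f)\<^sup>2 \<le> K * (?v * (vmax - ?v))" using v(3) by (simp add: pos_divide_le_eq)
    have far: "\<phi>\<^sup>2 / (4 * K * vmax) \<le> z" if "\<phi>/2 \<le> \<bar>?v - ?f\<bar>" "?v * (vmax - ?v) \<le> z * vmax" for z
    proof -
      have "(\<phi>/2)\<^sup>2 \<le> (?v - ?f)\<^sup>2" using that(1) \<phi> by (metis abs_le_square_iff abs_of_pos half_gt_zero)
      also note err
      also have "K * (?v * (vmax - ?v)) \<le> K * (z * vmax)" using that(2) K by (intro mult_left_mono) auto
      finally have "\<phi>\<^sup>2 \<le> z * (4 * K * vmax)" by (simp add: power_divide mult_ac)
      then show ?thesis using K vmax_pos by (simp add: pos_divide_le_eq)
    qed
    have "d \<le> ?v"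
    proof (cases "?v \<le> \<phi>/2")
      case True
      have "\<phi>\<^sup>2 / (4 * K * vmax) \<le> ?v"
        using True f v by (intro far mult_left_mono) auto
      then show ?thesis by (simp add: d_def)
    qed (simp add: d_def)
    moreover have "d \<le> vmax - ?v"
    proof (cases "vmax - ?v \<le> \<phi>/2")
      case True
      have "?v * (vmax - ?v) \<le> vmax * (vmax - ?v)" using v by (intro mult_right_mono) auto
      then have "\<phi>\<^sup>2 / (4 * K * vmax) \<le> vmax - ?v"
        using True f v by (intro far) (auto simp: mult.commute)
      then show ?thesis by (simp add: d_def)
    qed (simp add: d_def)
    ultimately show ?thesis by simp
  qed
  then show ?thesis using d by blast
qed

lemma compact_sublevel: "compact {x \<in> Om. U x \<le> r}"
proof -
  obtain e where e: "e > 0" "\<And>x i. x \<in> Om \<Longrightarrow> U x \<le> r \<Longrightarrow> L + e \<le> gp (fst x) i"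
    using sublevel_gap[of r] by blast
  obtain d where d: "d > 0" "\<And>x i. x \<in> Om \<Longrightarrow> U x \<le> r \<Longrightarrow> i \<in> {1..n} \<Longrightarrow> d \<le> snd x i \<and> snd x i \<le> vmax - d"
    using sublevel_speed[of r] by blast
  define A where "A = {s :: nat \<Rightarrow> real. \<forall>i. s i \<in> (if i \<in> {2..n} then {L + e..R} else {0})}"
  define B where "B = {v :: nat \<Rightarrow> real. \<forall>i. v i \<in> (if i \<in> {1..n} then {d..vmax - d} else {0})}"
  define K where "K = (A \<times> B) \<inter> {x. L + e \<le> gp (fst x) 1}"
  have "compact (A \<times> B)"
    unfolding A_def B_def by (intro compact_Times compact_coordinatewise) auto
  moreover have "closed {x::state. L + e \<le> gp (fst x) 1}"
    by (intro closed_Collect_le continuous_on_const continuous_gap)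
  ultimately have K: "compact K" unfolding K_def by (rule compact_Int_closed)
  have "K \<subseteq> Om"
  proof
    fix x assume x: "x \<in> K"
    then have coords: "fst x i \<in> (if i \<in> {2..n} then {L + e..R} else {0})"
      "snd x i \<in> (if i \<in> {1..n} then {d..vmax - d} else {0})" for i
      by (auto simp only: K_def A_def B_def mem_Times_iff Int_iff mem_Collect_eq)
    have "L < fst x i" if "i \<in> {2..n}" for i
      using coords(1)[of i] that e(1) by simp
    moreover have "fst x i = 0" if "i \<notin> {2..n}" for i
      using coords(1)[of i] that by (simp only: if_False singleton_iff)
    moreover have "0 < snd x i" "snd x i < vmax" if "i \<in> {1..n}" for i
      using coords(2)[of i] that d(1) by simp_all
    moreover have "snd x i = 0" if "i \<notin> {1..n}" for i
      using coords(2)[of i] that by (simp only: if_False singleton_iff)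
    moreover have "L + (\<Sum>i=2..n. fst x i) < R"
      using x e(1) by (simp add: K_def gap_def)
    ultimately show "x \<in> Om" by (simp add: Omega_def case_prod_unfold)
  qed
  have "{x \<in> Om. U x \<le> r} \<subseteq> K"
  proof
    fix x assume "x \<in> {x \<in> Om. U x \<le> r}"
    then have x: "x \<in> Om" "U x \<le> r" by auto
    have "fst x i \<in> (if i \<in> {2..n} then {L + e..R} else {0})" for i
      using e(2)[OF x, of i] gap_less[OF x(1), of i] x(1) by (auto simp: gap_def Omega_def)
    moreover have "snd x i \<in> (if i \<in> {1..n} then {d..vmax - d} else {0})" for i
      using d(2)[OF x, of i] x(1) by (auto simp: Omega_def)
    ultimately show "x \<in> K" using e(2)[OF x, of 1] by (simp add: K_def A_def B_def mem_Times_iff)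
  qed
  then have eq: "{x \<in> Om. U x \<le> r} = {x \<in> K. U x \<le> r}" using \<open>K \<subseteq> Om\<close> by auto
  have "closed {x \<in> K. U x \<le> r}"
    using \<open>K \<subseteq> Om\<close> K
    by (intro continuous_on_closed_Collect_le continuous_on_const continuous_on_subset[OF continuous_U] compact_imp_closed)
  with K have "compact (K \<inter> {x \<in> K. U x \<le> r})" by (rule compact_Int_closed)
  then show ?thesis unfolding eq by (simp add: Int_def conj_assoc[symmetric] cong: conj_cong)
qed

section \<open>Dissipation along solutions\<close>

definition velocity :: "nat + nat \<Rightarrow> state \<Rightarrow> real" where
  "velocity k x = (case k of
      Inl i \<Rightarrow> sp (snd x) (i - 1) - sp (snd x) i
    | Inr i \<Rightarrow> F_ring n R vmax vstar \<mu> V b i x)"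

definition idx :: "(nat + nat) set" where
  "idx = Inl ` {2..n} \<union> Inr ` {1..n}"

abbreviation sol :: "real set \<Rightarrow> (real \<Rightarrow> state) \<Rightarrow> bool" where
  "sol \<equiv> ring_solution n R L vmax vstar \<mu> V b"

lemma sol_iff:
  "sol J x \<longleftrightarrow> is_interval J \<and> 0 \<in> J \<and> J \<subseteq> {0..} \<and>
     (\<forall>t\<in>J. x t \<in> Om \<and>
        (\<forall>k\<in>idx. ((\<lambda>\<tau>. coord k (x \<tau>)) has_real_derivative velocity k (x t)) (at t within J)))"
  by (simp add: ring_solution_def idx_def coord_def velocity_def ball_Un)

lemma continuous_velocity:
  assumes "k \<in> idx"
  shows "continuous_on Om (velocity k)"
proof (cases k)
  case (Inl i)
  then show ?thesis
    unfolding velocity_def by (auto intro!: continuous_intros continuous_speed)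
next
  case (Inr i)
  then have i: "i \<in> {1..n}" using assms by (auto simp: idx_def)
  have nz: "snd x i \<noteq> 0" "vmax - snd x i \<noteq> 0" "beta vmax (snd x i) (f i (fst x)) \<noteq> 0" if "x \<in> Om" for x
    using speed_bounds[OF that i] beta_pos[OF speed_bounds(1,2)[OF that i] f_bounds, of i "fst x"] by auto
  have "continuous_on Om (\<lambda>x. beta vmax (snd x i) (f i (fst x)))"
    unfolding beta_def using nz
    by (auto intro!: continuous_intros continuous_f continuous_snd_coord)
  moreover have "continuous_on Om (\<lambda>x. Z_ring n R vmax V b i x)"
    unfolding Z_ring_def case_prod_unfold
    by (intro continuous_intros continuous_V_gap continuous_b_dV continuous_speed)
  ultimately have "continuous_on Om (\<lambda>x. F_ring n R vmax vstar \<mu> V b i x)"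
    unfolding F_ring_def case_prod_unfold prod.collapse using nz
    by (auto intro!: continuous_intros continuous_f continuous_snd_coord continuous_V_gap)
  then show ?thesis using Inr by (simp add: velocity_def)
qed

lemma speed_inner: "i \<in> {1..n} \<Longrightarrow> sp v i = v i"
  by (simp add: speed_def)

text \<open>The spacing that is determined by the others obeys the same equation as they do, with index \<open>1\<close> as
well as with index \<open>n + 1\<close>.\<close>

lemma gap_derivative:
  assumes "sol J x" "t \<in> J" "i \<in> {1..n + 1}"
  shows "((\<lambda>\<tau>. gp (fst (x \<tau>)) i) has_real_derivative sp (snd (x t)) (i - 1) - sp (snd (x t)) i) (at t within J)"
proof -
  have D: "((\<lambda>\<tau>. fst (x \<tau>) j) has_real_derivative sp (snd (x t)) (j - 1) - sp (snd (x t)) j) (at t within J)"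
    if "j \<in> {2..n}" for j
    using assms(1,2) that by (simp add: ring_solution_def)
  show ?thesis
  proof (cases "i \<in> {2..n}")
    case True
    then show ?thesis using D[OF True] by (simp add: gap_def)
  next
    case False
    have "((\<lambda>\<tau>. R - (\<Sum>j=2..n. fst (x \<tau>) j)) has_real_derivative
        0 - (\<Sum>j=2..n. sp (snd (x t)) (j - 1) - sp (snd (x t)) j)) (at t within J)"
      by (intro DERIV_diff DERIV_const DERIV_sum D)
    also have "(\<Sum>j=2..n. sp (snd (x t)) (j - 1) - sp (snd (x t)) j)
        = - (\<Sum>j=Suc 1..n. sp (snd (x t)) j - sp (snd (x t)) (j - 1))"
      by (simp add: numeral_2_eq_2 flip: sum_negf)
    also have "\<dots> = sp (snd (x t)) 1 - sp (snd (x t)) n"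
      using n_ge by (subst sum_telescope'') auto
    also have "0 - (sp (snd (x t)) 1 - sp (snd (x t)) n) = sp (snd (x t)) (i - 1) - sp (snd (x t)) i"
    proof -
      have "i = 1 \<or> i = n + 1" using False assms(3) by auto
      then show ?thesis using n_ge by (auto simp: speed_def)
    qed
    finally show ?thesis using False by (simp only: gap_def if_False)
  qed
qed

text \<open>The term \<open>Z\<close> of the feedback is, up to the factor \<open>vmax\<^sup>2\<close>, the time derivative of the target speed.\<close>

lemma f_derivative:
  assumes x: "sol J x" "t \<in> J" and i: "i \<in> {1..n}"
  shows "\<exists>q'. ((\<lambda>\<tau>. f i (fst (x \<tau>))) has_real_derivative q') (at t within J) \<and>
     Z_ring n R vmax V b i (x t) = vmax\<^sup>2 * q'"
proof -
  have Om: "x t \<in> Om" using x by (simp add: ring_solution_def)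
  have g: "((\<lambda>\<tau>. V1 (gp (fst (x \<tau>)) j)) has_real_derivative
      V2 (gp (fst (x t)) j) * (sp (snd (x t)) (j - 1) - sp (snd (x t)) j)) (at t within J)"
    if "j \<in> {1..n + 1}" for j
    by (rule DERIV_chain2[OF V_derivs(2)[OF gap_gt[OF Om]] gap_derivative[OF x that]])
  have "((\<lambda>\<tau>. vstar - b (dV i (fst (x \<tau>)))) has_real_derivative
     0 - deriv b (dV i (fst (x t))) *
       (V2 (gp (fst (x t)) (i + 1)) * (sp (snd (x t)) (i + 1 - 1) - sp (snd (x t)) (i + 1))
        - V2 (gp (fst (x t)) i) * (sp (snd (x t)) (i - 1) - sp (snd (x t)) i))) (at t within J)"
    using i by (intro DERIV_diff DERIV_const DERIV_chain2[OF b_derivative] g) auto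
  then have "((\<lambda>\<tau>. f i (fst (x \<tau>))) has_real_derivative
     - deriv b (dV i (fst (x t))) *
       (V2 (gp (fst (x t)) (i + 1)) * (sp (snd (x t)) i - sp (snd (x t)) (i + 1))
        - V2 (gp (fst (x t)) i) * (sp (snd (x t)) (i - 1) - sp (snd (x t)) i))) (at t within J)"
    by (simp add: f_ring_def)
  moreover have "Z_ring n R vmax V b i (x t) = vmax\<^sup>2 * (- deriv b (dV i (fst (x t))) *
       (V2 (gp (fst (x t)) (i + 1)) * (sp (snd (x t)) i - sp (snd (x t)) (i + 1))
        - V2 (gp (fst (x t)) i) * (sp (snd (x t)) (i - 1) - sp (snd (x t)) i)))"
    by (simp add: Z_ring_def case_prod_unfold)
  ultimately show ?thesis by blast
qed

lemma sum_dV: "(\<Sum>i=1..n. dV i s) = 0"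
proof -
  have "(\<Sum>i=1..n. V1 (gp s (i - 1 + 1))) = (\<Sum>i=1..n. V1 (gp s (i + 1)))"
    using sum_cyclic_shift[of "\<lambda>i. V1 (gp s (i + 1))" n] gap_last[of s] by simp
  moreover have "(\<Sum>i=1..n. V1 (gp s (i - 1 + 1))) = (\<Sum>i=1..n. V1 (gp s i))"
    by (intro sum.cong) auto
  ultimately show ?thesis by (simp add: sum_subtractf)
qed

text \<open>After \<open>kinetic_term_derivative\<close> the kinetic part contributes \<open>- e\<^sub>i * dV i\<close> besides its damping.
Summation by parts around the ring turns the derivative of the potential into \<open>\<Sum> v\<^sub>i * dV i\<close>. What
is left of these two is \<open>\<Sum> f\<^sub>i * dV i\<close> with \<open>f\<^sub>i = vstar - b (dV i)\<close>, and the constant \<open>vstar\<close> drops out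
because the \<open>dV i\<close> add up to zero.\<close>

lemma U_derivative:
  assumes x: "sol J x" and t: "t \<in> J"
  shows "((\<lambda>\<tau>. U (x \<tau>)) has_real_derivative - dissipation (x t)) (at t within J)"
proof -
  have Om: "x t \<in> Om" using x t by (simp add: ring_solution_def)
  let ?s = "fst (x t)" and ?v = "snd (x t)"
  let ?e = "\<lambda>i. ?v i - f i ?s" and ?w = "\<lambda>i. ?v i * (vmax - ?v i)"
  have K: "((\<lambda>\<tau>. vmax\<^sup>2 / 2 * ((snd (x \<tau>) i - f i (fst (x \<tau>)))\<^sup>2 / (snd (x \<tau>) i * (vmax - snd (x \<tau>) i))))
     has_real_derivative - \<mu> * vmax\<^sup>2 * ((?e i)\<^sup>2 / ?w i) + ?e i * (- dV i ?s)) (at t within J)"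
    if i: "i \<in> {1..n}" for i
  proof -
    obtain q' where q: "((\<lambda>\<tau>. f i (fst (x \<tau>))) has_real_derivative q') (at t within J)"
      "Z_ring n R vmax V b i (x t) = vmax\<^sup>2 * q'"
      using f_derivative[OF x t i] by blast
    have p: "((\<lambda>\<tau>. snd (x \<tau>) i) has_real_derivative F_ring n R vmax vstar \<mu> V b i (x t)) (at t within J)"
      using x t i by (simp add: ring_solution_def)
    show ?thesis
      by (rule kinetic_term_derivative[OF p q(1)])
         (use speed_bounds[OF Om i] f_bounds q(2) in \<open>simp_all add: F_ring_def case_prod_unfold\<close>)
  qed
  have P: "((\<lambda>\<tau>. V (gp (fst (x \<tau>)) i) - V rho) has_real_derivative
      V1 (gp ?s i) * (sp ?v (i - 1) - sp ?v i)) (at t within J)" if "i \<in> {1..n}" for i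
    using DERIV_diff[OF DERIV_chain2[OF V_derivs(1)[OF gap_gt[OF Om]] gap_derivative[OF x t]] DERIV_const, of i "V rho"] that
    by simp
  have D: "((\<lambda>\<tau>. U (x \<tau>)) has_real_derivative
     (\<Sum>i=1..n. - \<mu> * vmax\<^sup>2 * ((?e i)\<^sup>2 / ?w i) + ?e i * (- dV i ?s))
     + (\<Sum>i=1..n. V1 (gp ?s i) * (sp ?v (i - 1) - sp ?v i))) (at t within J)"
    unfolding U_eq kinetic_def potential_def sum_distrib_left
    by (intro DERIV_add DERIV_sum K P)
  have "(\<Sum>i=1..n. V1 (gp ?s i) * sp ?v (i - 1)) = (\<Sum>i=1..n. V1 (gp ?s (i - 1 + 1)) * sp ?v (i - 1))"
    by (intro sum.cong) auto
  also have "\<dots> = (\<Sum>i=1..n. V1 (gp ?s (i + 1)) * sp ?v i)"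
    using n_ge by (intro sum_cyclic_shift[where h = "\<lambda>i. V1 (gp ?s (i + 1)) * sp ?v i"]) (simp add: gap_def speed_def)
  finally have shift: "(\<Sum>i=1..n. V1 (gp ?s i) * sp ?v (i - 1)) = (\<Sum>i=1..n. V1 (gp ?s (i + 1)) * sp ?v i)" .
  have "(\<Sum>i=1..n. V1 (gp ?s i) * (sp ?v (i - 1) - sp ?v i)) = (\<Sum>i=1..n. sp ?v i * dV i ?s)"
    unfolding right_diff_distrib sum_subtractf shift by (simp only: mult.commute)
  also have "\<dots> = (\<Sum>i=1..n. ?v i * dV i ?s)"
    by (intro sum.cong) (auto simp: speed_inner)
  finally have "(\<Sum>i=1..n. - \<mu> * vmax\<^sup>2 * ((?e i)\<^sup>2 / ?w i) + ?e i * (- dV i ?s))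
      + (\<Sum>i=1..n. V1 (gp ?s i) * (sp ?v (i - 1) - sp ?v i))
      = (\<Sum>i=1..n. - \<mu> * vmax\<^sup>2 * ((?e i)\<^sup>2 / ?w i) + ?e i * (- dV i ?s)) + (\<Sum>i=1..n. ?v i * dV i ?s)"
    by (simp only:)
  also have "\<dots> = (\<Sum>i=1..n. vstar * dV i ?s - dV i ?s * b (dV i ?s) - \<mu> * vmax\<^sup>2 * ((?e i)\<^sup>2 / ?w i))"
    unfolding sum.distrib[symmetric]
    by (intro sum.cong) (simp_all add: f_ring_def algebra_simps)
  also have "\<dots> = - dissipation (x t)"
  proof -
    have split: "(\<Sum>i\<in>A. k * a i - c i - l * d i) = k * sum a A - sum c A - l * sum d A"
      for k l :: real and a c d :: "nat \<Rightarrow> real" and A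
      by (simp add: sum_subtractf sum_distrib_left)
    show ?thesis unfolding split sum_dV dissipation_def kinetic_def by simp
  qed
  finally show ?thesis using D by (simp only:)
qed

lemma solution_decay:
  assumes x: "sol J x" and t: "t \<in> J"
    and rate: "\<And>y. y \<in> Om \<Longrightarrow> U y \<le> U (x 0) \<Longrightarrow> w * U y \<le> dissipation y"
  shows "U (x t) \<le> U (x 0)" and "U (x t) \<le> U (x 0) * exp (- w * t)"
proof -
  have J: "{0..\<tau>} \<subseteq> J" if "\<tau> \<in> J" for \<tau>
    using x that by (auto simp: ring_solution_def is_interval_1)
  have pos: "0 \<le> \<tau>" if "\<tau> \<in> J" for \<tau> using x that by (auto simp: ring_solution_def)
  have Om: "x \<tau> \<in> Om" if "\<tau> \<in> J" for \<tau> using x that by (simp add: ring_solution_def)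
  have D: "((\<lambda>\<tau>. U (x \<tau>)) has_real_derivative - dissipation (x \<tau>)) (at \<tau> within {0..s})"
    if "\<tau> \<in> {0..s}" "s \<in> J" for \<tau> s
    using J[OF that(2)] that(1) by (blast intro: DERIV_subset[OF U_derivative[OF x]])
  have le: "U (x s) \<le> U (x 0)" if "s \<in> J" for s
  proof -
    have "U (x s) \<le> U (x 0) * exp (- 0 * s)"
      using that J[OF that] dissipation_nonneg[OF Om]
      by (intro exponential_decay[where d = "\<lambda>\<tau>. dissipation (x \<tau>)"] pos D) auto
    then show ?thesis by simp
  qed
  show "U (x t) \<le> U (x 0)" using t by (rule le)
  show "U (x t) \<le> U (x 0) * exp (- w * t)"
    using t J[OF t] rate[OF Om le]
    by (intro exponential_decay[where d = "\<lambda>\<tau>. dissipation (x \<tau>)"] pos D) auto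
qed

section \<open>Maximal solutions are global\<close>

lemma coordinate_box_in_Omega:
  assumes "x \<in> Om"
  shows "\<exists>r>0. \<forall>z. (\<forall>k. z k \<in> cball (coord k x) (if k \<in> idx then r else 0)) \<longrightarrow> of_coords z \<in> Om"
proof -
  have small: "\<forall>\<^sub>F r in at_right 0. c * r < m" if "0 < m" for c m :: real
  proof -
    have "((\<lambda>r. c * r) \<longlongrightarrow> c * 0) (at_right 0)" by (intro tendsto_intros)
    then show ?thesis using that by (intro order_tendstoD) auto
  qed
  have "\<forall>\<^sub>F r in at_right (0::real). 0 < r \<and> (\<forall>i\<in>{2..n}. 1 * r < fst x i - L) \<and>
      (\<forall>i\<in>{1..n}. 1 * r < snd x i) \<and> (\<forall>i\<in>{1..n}. 1 * r < vmax - snd x i) \<and>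
      real n * r < R - (L + (\<Sum>i=2..n. fst x i))"
    using assms
    by (intro eventually_conj eventually_ball_finite ballI small eventually_at_right_less)
       (auto simp: Omega_def)
  then obtain r where r: "0 < r" "\<And>i. i \<in> {2..n} \<Longrightarrow> r < fst x i - L" "\<And>i. i \<in> {1..n} \<Longrightarrow> r < snd x i"
     "\<And>i. i \<in> {1..n} \<Longrightarrow> r < vmax - snd x i" "real n * r < R - (L + (\<Sum>i=2..n. fst x i))"
    by (auto dest!: eventually_happens'[OF trivial_limit_at_right_real])
  have "of_coords z \<in> Om" if z: "\<And>k. z k \<in> cball (coord k x) (if k \<in> idx then r else 0)" for z
  proof -
    have s: "\<bar>fst x i - z (Inl i)\<bar> \<le> (if i \<in> {2..n} then r else 0)" for i
      using z[of "Inl i"] by (auto simp: idx_def coord_def dist_real_def split: if_splits)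
    have v: "\<bar>snd x i - z (Inr i)\<bar> \<le> (if i \<in> {1..n} then r else 0)" for i
      using z[of "Inr i"] by (auto simp: idx_def coord_def dist_real_def split: if_splits)
    have "z (Inl i) = 0" if "i \<notin> {2..n}" for i
      using s[of i] that assms by (auto simp: Omega_def)
    moreover have "z (Inr i) = 0" if "i \<notin> {1..n}" for i
      using v[of i] that assms by (auto simp: Omega_def)
    moreover have "L < z (Inl i)" if "i \<in> {2..n}" for i
      using s[of i] r(2)[OF that] that by (simp add: abs_le_iff)
    moreover have "z (Inr i) < vmax" "0 < z (Inr i)" if "i \<in> {1..n}" for i
      using v[of i] r(3,4)[OF that] that by (simp_all add: abs_le_iff)
    moreover have "L + (\<Sum>i=2..n. z (Inl i)) < R"
    proof -
      have "(\<Sum>i=2..n. z (Inl i)) \<le> (\<Sum>i=2..n. fst x i + r)"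
      proof (rule sum_mono)
        fix i assume "i \<in> {2..n}"
        then show "z (Inl i) \<le> fst x i + r" using s[of i] by (simp add: abs_le_iff)
      qed
      also have "\<dots> = (\<Sum>i=2..n. fst x i) + real (n - 1) * r" by (simp add: sum.distrib)
      also have "\<dots> \<le> (\<Sum>i=2..n. fst x i) + real n * r"
        using r(1) by (intro add_left_mono mult_right_mono) auto
      finally show ?thesis using r(5) by linarith
    qed
    ultimately show ?thesis by (simp add: of_coords_def Omega_def)
  qed
  then show ?thesis using r(1) by blast
qed

lemma finite_idx: "finite idx"
  by (simp add: idx_def)

lemma local_existence:
  assumes "x0 \<in> Om"
  obtains h y where "h > 0" "y 0 = x0" "sol {0..h} y"
proof -
  obtain r where r: "r > 0"
    "\<And>z. (\<forall>k. z k \<in> cball (coord k x0) (if k \<in> idx then r else 0)) \<Longrightarrow> of_coords z \<in> Om"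
    using coordinate_box_in_Omega[OF assms] by blast
  define B where "B = {z. \<forall>k. z k \<in> cball (coord k x0) (if k \<in> idx then r else 0)}"
  have cont: "continuous_on B (\<lambda>z. velocity k (of_coords z))" if "k \<in> idx" for k
  proof (rule continuous_on_compose2[OF continuous_velocity[OF that] continuous_on_of_coords])
    show "continuous_on B (\<lambda>z. z j)" for j
      by (rule continuous_on_product_then_coordinatewise) (rule continuous_on_id)
    show "of_coords ` B \<subseteq> Om" using r(2) by (auto simp: B_def)
  qed
  show ?thesis
  proof (rule peano_existence[of idx r B "\<lambda>k. coord k x0" "\<lambda>z k. velocity k (of_coords z)",
          OF finite_idx r(1) B_def cont])
    fix h y
    assume y: "h > 0" "y 0 = (\<lambda>k. coord k x0)" "\<And>t. t \<in> {0..h} \<Longrightarrow> y t \<in> B"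
      "\<And>t k. t \<in> {0..h} \<Longrightarrow> k \<in> idx \<Longrightarrow>
         ((\<lambda>\<tau>. y \<tau> k) has_real_derivative velocity k (of_coords (y t))) (at t within {0..h})"
    have "of_coords (y t) \<in> Om" if "t \<in> {0..h}" for t
      using y(3)[OF that] r(2) by (simp add: B_def)
    then have "sol {0..h} (\<lambda>t. of_coords (y t))"
      unfolding sol_iff using y(1,4) by (simp add: is_interval_cc)
    then show ?thesis
      using that[of h "\<lambda>t. of_coords (y t)"] y(1,2) by simp
  qed
qed

text \<open>The solution stays in a compact sublevel set of \<open>U\<close>, where the vector field is bounded. Its
coordinates therefore extend continuously to \<open>T\<close>; the limit lies in the same compact set, hence in
\<open>\<Omega>\<close>, and the equation at \<open>T\<close> follows by continuity of the vector field.\<close>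

lemma solution_right_closure:
  assumes x: "sol {0..<T} x" and T: "0 < T"
  obtains y where "sol {0..T} y" "\<And>t. t \<in> {0..<T} \<Longrightarrow> y t = x t"
proof -
  define K where "K = {z \<in> Om. U z \<le> U (x 0)}"
  have K: "compact K" "K \<subseteq> Om" unfolding K_def by (auto intro: compact_sublevel)
  have xOm: "x t \<in> Om" if "t \<in> {0..<T}" for t
    using x that by (simp add: ring_solution_def)
  have xK: "x t \<in> K" if "t \<in> {0..<T}" for t
    using solution_decay(1)[OF x that, of 0] dissipation_nonneg xOm[OF that] by (auto simp: K_def)
  have D: "((\<lambda>\<tau>. coord k (x \<tau>)) has_real_derivative velocity k (x t)) (at t within {0..<T})"
    if "t \<in> {0..<T}" "k \<in> idx" for k t
    using x that unfolding sol_iff by blast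
  have "\<exists>g. continuous_on {0..T} g \<and> (\<forall>t\<in>{0..<T}. g t = coord k (x t))" for k
  proof (cases "k \<in> idx")
    case True
    have "bounded (velocity k ` K)"
      using K continuous_on_subset[OF continuous_velocity[OF True]]
      by (intro compact_imp_bounded compact_continuous_image) auto
    then obtain M where "\<And>z. z \<in> K \<Longrightarrow> \<bar>velocity k z\<bar> \<le> M"
      by (auto simp: bounded_iff)
    then show ?thesis
      using bounded_derivative_extension[OF T D[OF _ True], of M] xK by metis
  next
    case False
    have "coord k (x t) = 0" if "t \<in> {0..<T}" for t
      using xOm[OF that] False
      by (cases k) (auto simp: idx_def coord_def Omega_def image_iff)
    then show ?thesis by (intro exI[of _ "\<lambda>_. 0"]) auto
  qed
  then obtain g where g: "\<And>k. continuous_on {0..T} (g k)" "\<And>k t. t \<in> {0..<T} \<Longrightarrow> g k t = coord k (x t)"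
    by metis
  define y where "y = (\<lambda>t. of_coords (\<lambda>k. g k t))"
  have yx: "y t = x t" if "t \<in> {0..<T}" for t
    using g(2)[OF that] by (simp add: y_def)
  have ycont: "continuous_on {0..T} y"
    unfolding y_def by (intro continuous_on_of_coords g(1))
  have cl: "closure {0..<T} = {0..T}" using T by simp
  have yK: "y t \<in> K" if "t \<in> {0..T}" for t
  proof -
    \<comment> \<open>The endpoint value stays in \<open>K\<close> because \<open>K\<close> is closed.\<close>
    have "y ` closure {0..<T} \<subseteq> K"
      using ycont K xK yx by (intro image_closure_subset) (auto simp: cl compact_imp_closed)
    then show ?thesis using that cl by blast
  qed
  have "((\<lambda>\<tau>. coord k (y \<tau>)) has_real_derivative velocity k (y t)) (at t within {0..T})"
    if t: "t \<in> {0..T}" and k: "k \<in> idx" for t k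
  proof -
    have inner: "((\<lambda>\<tau>. coord k (y \<tau>)) has_real_derivative velocity k (y s)) (at s within {0..<T})"
      if "s \<in> {0..<T}" for s
      unfolding yx[OF that] by (rule has_real_derivative_cong_within[OF D[OF that k] that]) (simp add: yx)
    show ?thesis
    proof (cases "t = T")
      case False
      have "at t within {0..<T} = at t within {0..T}"
        using t False by (intro at_within_nhd[of t "{..<T}"]) auto
      then show ?thesis using inner[of t] t False by simp
    next
      case True
      have "continuous_on {0..T} (\<lambda>\<tau>. velocity k (y \<tau>))"
        by (rule continuous_on_compose2[OF continuous_velocity[OF k] ycont]) (use yK K in auto)
      then have lim: "((\<lambda>\<tau>. velocity k (y \<tau>)) \<longlongrightarrow> velocity k (y T)) (at T within {0..T})"
        using T by (auto simp: continuous_on_def)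
      show ?thesis unfolding True
      proof (rule derivative_at_right_endpoint[OF T])
        show "continuous_on {0..T} (\<lambda>\<tau>. coord k (y \<tau>))"
          using g(1) by (simp add: y_def)
        show "((\<lambda>\<tau>. velocity k (y \<tau>)) \<longlongrightarrow> velocity k (y T)) (at_left T)"
          using lim T by (simp add: at_within_Icc_at_left)
        fix s assume "s \<in> {0<..<T}"
        then have s: "s \<in> {0..<T}" "s \<in> {0<..<T}" by auto
        have "((\<lambda>\<tau>. coord k (y \<tau>)) has_real_derivative velocity k (y s)) (at s within {0<..<T})"
          by (rule DERIV_subset[OF inner[OF s(1)]]) auto
        then show "((\<lambda>\<tau>. coord k (y \<tau>)) has_real_derivative velocity k (y s)) (at s)"
          by (simp only: at_within_open[OF s(2) open_greaterThanLessThan])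
      qed
    qed
  qed
  then have "sol {0..T} y"
    unfolding sol_iff using yK K T by (auto simp: is_interval_cc)
  then show ?thesis using yx that by blast
qed

text \<open>A local solution that starts at \<open>x T\<close> is attached, shifted in time by \<open>T\<close>. At \<open>T\<close> the two one-sided
derivatives agree.\<close>

lemma solution_continuation:
  assumes x: "sol {0..T} x"
  obtains h y where "h > 0" "sol {0..T + h} y" "\<And>t. t \<in> {0..T} \<Longrightarrow> y t = x t"
proof -
  have T: "0 \<le> T" and xT: "x T \<in> Om" using x by (auto simp: ring_solution_def)
  obtain h z where z: "h > 0" "z 0 = x T" "sol {0..h} z"
    using local_existence[OF xT] .
  define y where "y = (\<lambda>t. if t \<le> T then x t else z (t - T))"
  have yx: "y t = x t" if "t \<in> {0..T}" for t using that by (simp add: y_def)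
  have yz: "y t = z (t - T)" if "t \<in> {T..T + h}" for t using that z(2) by (auto simp: y_def)
  have Un: "{0..T} \<union> {T..T + h} = {0..T + h}" using T z(1) by auto
  have "((\<lambda>\<tau>. coord k (y \<tau>)) has_real_derivative velocity k (y t)) (at t within {0..T + h})"
    if t: "t \<in> {0..T + h}" and k: "k \<in> idx" for t k
    unfolding Un[symmetric]
  proof (rule has_real_derivative_within_Un)
    show "((\<lambda>\<tau>. coord k (y \<tau>)) has_real_derivative velocity k (y t)) (at t within {0..T})"
    proof (cases "t \<in> {0..T}")
      case True
      have "((\<lambda>\<tau>. coord k (x \<tau>)) has_real_derivative velocity k (x t)) (at t within {0..T})"
        using x k True unfolding sol_iff by blast
      then show ?thesis
        unfolding yx[OF True] by (rule has_real_derivative_cong_within[OF _ True]) (simp add: yx)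
    next
      case False
      then have "at t within {0..T} = bot" by (intro at_within_eq_bot_iff[THEN iffD2]) auto
      then show ?thesis by (simp add: has_field_derivative_iff)
    qed
    show "((\<lambda>\<tau>. coord k (y \<tau>)) has_real_derivative velocity k (y t)) (at t within {T..T + h})"
    proof (cases "t \<in> {T..T + h}")
      case True
      have img: "(\<lambda>\<tau>. \<tau> - T) ` {T..T + h} = {0..h}"
        by (auto simp: image_iff intro!: bexI[of _ "_ + T"])
      have "((\<lambda>\<tau>. coord k (z \<tau>)) has_real_derivative velocity k (z (t - T))) (at (t - T) within {0..h})"
        using z(3) k True unfolding sol_iff by auto
      then have "((\<lambda>\<tau>. coord k (z \<tau>)) \<circ> (\<lambda>\<tau>. \<tau> - T) has_real_derivative velocity k (z (t - T)) * 1) (at t within {T..T + h})"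
        by (intro DERIV_image_chain) (auto simp: img intro!: derivative_eq_intros)
      then show ?thesis
        unfolding yz[OF True] mult_1_right
        by (rule has_real_derivative_cong_within[OF _ True]) (simp add: yz)
    next
      case False
      then have "at t within {T..T + h} = bot" by (intro at_within_eq_bot_iff[THEN iffD2]) auto
      then show ?thesis by (simp add: has_field_derivative_iff)
    qed
  qed
  moreover have "y t \<in> Om" if "t \<in> {0..T + h}" for t
    using x z(3) that by (auto simp: y_def ring_solution_def)
  ultimately have "sol {0..T + h} y"
    unfolding sol_iff using T z(1) by (auto simp: is_interval_cc)
  then show ?thesis using that z(1) yx by blast
qed

theorem maximal_solution_global:
  assumes "maximal_ring_solution n R L vmax vstar \<mu> V b J x"
  shows "J = {0..}"
proof (rule ccontr)
  assume ne: "J \<noteq> {0..}"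
  have x: "sol J x" and max: "\<And>J' x'. sol J' x' \<Longrightarrow> J \<subseteq> J' \<Longrightarrow> (\<And>t. t \<in> J \<Longrightarrow> x' t = x t) \<Longrightarrow> J' = J"
    using assms unfolding maximal_ring_solution_def by blast+
  have J: "0 \<in> J" "J \<subseteq> {0..}" "\<And>a b c. a \<in> J \<Longrightarrow> b \<in> J \<Longrightarrow> a \<le> c \<Longrightarrow> c \<le> b \<Longrightarrow> c \<in> J"
    using x unfolding ring_solution_def is_interval_1 by blast+
  \<comment> \<open>A time missing from the interval \<open>J\<close> is an upper bound of it.\<close>
  obtain m where m: "m \<ge> 0" "m \<notin> J" using ne J(2) by auto
  have bdd: "bdd_above J" using J(1,3) m by (intro bdd_aboveI[of _ m]) (metis le_cases)
  define T where "T = Sup J"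
  have T: "0 \<le> T" unfolding T_def using J(1) bdd by (rule cSup_upper)
  have le: "t \<le> T" if "t \<in> J" for t unfolding T_def using that bdd by (rule cSup_upper)
  have below: "t \<in> J" if "0 \<le> t" "t < T" for t
  proof -
    obtain s where s: "s \<in> J" "t < s" using \<open>t < T\<close> less_cSup_iff[of J t] J(1) bdd unfolding T_def by auto
    then show ?thesis using J(1) J(3)[of 0 s t] \<open>0 \<le> t\<close> by simp
  qed
  show False
  proof (cases "T \<in> J")
    case True
    then have "J = {0..T}" using le below J(2) by (auto simp: less_eq_real_def)
    with x have "sol {0..T} x" by simp
    then obtain h y where y: "h > 0" "sol {0..T + h} y" "\<And>t. t \<in> {0..T} \<Longrightarrow> y t = x t"
      using solution_continuation by metis
    then have "{0..T + h} = J" using \<open>J = {0..T}\<close> by (intro max[of _ y]) auto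
    moreover have "T + h \<in> {0..T + h}" using T y(1) by simp
    ultimately show False using le[of "T + h"] y(1) by simp
  next
    case False
    then have JT: "J = {0..<T}" using le below J(2) by (auto simp: less_le)
    then have "0 < T" using J(1) by auto
    moreover have "sol {0..<T} x" using x JT by simp
    ultimately obtain y where y: "sol {0..T} y" "\<And>t. t \<in> {0..<T} \<Longrightarrow> y t = x t"
      using solution_right_closure by metis
    then have "{0..T} = J" using JT by (intro max[of _ y]) auto
    then show False using False T by auto
  qed
qed

section \<open>Stability\<close>

text \<open>At the rate \<open>\<omega> u\<close> that belongs to the initial level \<open>u\<close>, the level has dropped to at most
\<open>u * exp (- u) \<le> 1\<close> by the time \<open>u / \<omega> u\<close>. After that the rate \<open>\<omega> 1\<close> applies, whatever \<open>u\<close> was; the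
delay costs the factor \<open>exp (\<omega> 1 * u / \<omega> u)\<close>.\<close>

lemma exponential_stability:
  fixes c :: real
  assumes \<omega>: "continuous_on UNIV \<omega>" "antimono \<omega>" "\<And>r. \<omega> r > 0"
    and rate: "\<And>x r. x \<in> Om \<Longrightarrow> 0 \<le> U x \<Longrightarrow> U x \<le> r \<Longrightarrow> \<omega> r * U x \<le> dissipation x"
    and x: "sol {0..} x" and t: "0 \<le> t"
  shows "U (x t) \<le> U (x 0) * exp (\<omega> 1 * U (x 0) / \<omega> (U (x 0))) * exp (- \<omega> 1 * t)"
proof -
  have Om: "x s \<in> Om" if "0 \<le> s" for s using x that by (simp add: ring_solution_def)
  let ?u = "U (x 0)"
  have u: "0 \<le> ?u" using Om[of 0] U_nonneg by simp
  define T where "T = ?u / \<omega> ?u"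
  have T: "0 \<le> T" unfolding T_def using u \<omega>(3)[of ?u] by simp
  have dec: "U (x s) \<le> ?u" "U (x s) \<le> ?u * exp (- \<omega> ?u * s)" if "0 \<le> s" for s
    using solution_decay[OF x, of s "\<omega> ?u"] rate U_nonneg that by auto
  have goal_eq: "?u * exp (\<omega> 1 * ?u / \<omega> ?u) * exp (- \<omega> 1 * t) = ?u * exp (- \<omega> 1 * (t - T))"
    by (simp add: T_def algebra_simps mult_exp_exp)
  show ?thesis
  proof (cases "t \<le> T")
    case True
    have "?u * 1 \<le> ?u * exp (- \<omega> 1 * (t - T))"
      using True \<omega>(3)[of 1] u by (intro mult_left_mono) (auto simp: mult_nonneg_nonpos)
    then show ?thesis unfolding goal_eq using dec(1)[OF t] by simp
  next
    case False
    have le1: "U (x s) \<le> 1" if "T \<le> s" for s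
    proof -
      have "\<omega> ?u * s \<ge> ?u"
        using that \<omega>(3)[of ?u] by (simp add: T_def field_simps)
      then have "?u * exp (- \<omega> ?u * s) \<le> ?u * exp (- ?u)"
        using u by (intro mult_left_mono) auto
      also have "\<dots> \<le> 1"
      proof -
        have "?u \<le> exp ?u" using exp_ge_add_one_self[of ?u] by linarith
        then show ?thesis by (simp add: exp_minus field_simps)
      qed
      finally show ?thesis using dec(2)[of s] that T by linarith
    qed
    have "U (x (T + (t - T))) \<le> U (x (T + 0)) * exp (- \<omega> 1 * (t - T))"
    proof (rule exponential_decay[where u = "\<lambda>s. U (x (T + s))" and d = "\<lambda>s. dissipation (x (T + s))"])
      show "0 \<le> t - T" using False by simp
      fix s assume s: "s \<in> {0..t - T}"
      have "((\<lambda>s. U (x s)) has_real_derivative - dissipation (x (T + s))) (at (T + s) within (\<lambda>s. T + s) ` {0..t - T})"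
        using s T by (intro DERIV_subset[OF U_derivative[OF x]]) auto
      then have "((\<lambda>s. U (x s)) \<circ> (\<lambda>s. T + s) has_real_derivative - dissipation (x (T + s)) * 1) (at s within {0..t - T})"
        by (rule DERIV_image_chain) (auto intro!: derivative_eq_intros)
      then show "((\<lambda>s. U (x (T + s))) has_real_derivative - dissipation (x (T + s))) (at s within {0..t - T})"
        by (simp add: o_def)
      show "\<omega> 1 * U (x (T + s)) \<le> dissipation (x (T + s))"
        using s T by (intro rate le1 U_nonneg Om) auto
    qed
    also have "\<dots> \<le> ?u * exp (- \<omega> 1 * (t - T))"
      using dec(1)[of T] T by (intro mult_right_mono) auto
    finally show ?thesis unfolding goal_eq by simp
  qed
qed

lemma U_equilibrium: "U eqm = 0"
proof -
  have gap: "gp (fst eqm) i = rho" for i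
  proof (cases "i \<in> {2..n}")
    case False
    have "gp (fst eqm) i = R - (\<Sum>j=2..n. fst eqm j)"
      using False by (simp only: gap_def if_False)
    also have "(\<Sum>j=2..n. fst eqm j) = (\<Sum>j=2..n. rho)"
      by (rule sum.cong) (auto simp: equilibrium_def)
    also have "R - \<dots> = R - (real n - 1) * rho" using n_ge by (simp add: of_nat_diff)
    also have "\<dots> = rho" using n_ge by (simp add: field_simps)
    finally show ?thesis .
  qed (simp add: gap_def equilibrium_def)
  have "f i (fst eqm) = vstar" for i
    by (simp add: f_ring_def gap b_0)
  then have "kinetic eqm = 0" by (simp add: kinetic_def equilibrium_def)
  moreover have "potential eqm = 0" by (simp add: potential_def gap)
  ultimately show ?thesis by (simp add: U_eq)
qed

theorem stability:
  shows
    "(\<exists>\<sigma> a. class_KL \<sigma> \<and> class_K_inf a \<and>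
        (\<forall>J x. maximal_ring_solution n R L vmax vstar \<mu> V b J x \<longrightarrow>
           J = {0..} \<and>
           (\<forall>t\<ge>0. a (state_dist n (x t) eqm) \<le> U (x t) \<and> U (x t) \<le> \<sigma> (U (x 0)) t))) \<and>
     (\<exists>\<kappa> \<omega>. size_function Om \<kappa> \<and> \<kappa> eqm = 0 \<and> \<omega> > 0 \<and>
        (\<forall>J x. maximal_ring_solution n R L vmax vstar \<mu> V b J x \<longrightarrow>
           (\<forall>t\<ge>0. state_dist n (x t) eqm \<le> exp (- \<omega> * t) * \<kappa> (x 0))))"
proof -
  obtain c where c: "c > 0" "\<And>x. x \<in> Om \<Longrightarrow> c * (state_dist n x eqm)\<^sup>2 \<le> U x"
    using U_quadratic_lower by blast
  obtain \<omega> :: "real \<Rightarrow> real" where \<omega>: "continuous_on UNIV \<omega>" "antimono \<omega>" "\<And>r. \<omega> r > 0"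
    and rate: "\<And>x r. x \<in> Om \<Longrightarrow> 0 \<le> U x \<Longrightarrow> U x \<le> r \<Longrightarrow> \<omega> r * U x \<le> dissipation x"
    using uniform_decay_rate[OF dissipation_rate] by blast
  have global: "J = {0..}" "sol {0..} x" if "maximal_ring_solution n R L vmax vstar \<mu> V b J x" for J x
    using maximal_solution_global[OF that] that by (auto simp: maximal_ring_solution_def)
  have Om: "x t \<in> Om" if "sol {0..} x" "0 \<le> t" for x t
    using that by (simp add: ring_solution_def)
  have decay: "U (x t) \<le> U (x 0) * exp (- \<omega> (U (x 0)) * t)" if "sol {0..} x" "0 \<le> t" for x t
    using that rate U_nonneg by (intro solution_decay(2)) auto
  \<comment> \<open>The square of \<open>\<kappa>\<close> is the constant of the exponential estimate for \<open>U\<close>, divided by the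
    constant \<open>c\<close> that relates \<open>U\<close> to the squared distance; this halves the rate.\<close>
  define \<kappa> where "\<kappa> = (\<lambda>x. sqrt (U x * exp (\<omega> 1 * U x / \<omega> (U x)) / c))"
  have \<kappa>_lower: "U x \<le> c * (\<kappa> x)\<^sup>2" if "x \<in> Om" for x
  proof -
    have "U x * 1 \<le> U x * exp (\<omega> 1 * U x / \<omega> (U x))"
      using U_nonneg[OF that] \<omega>(3)[of 1] \<omega>(3)[of "U x"] by (intro mult_left_mono) auto
    then show ?thesis using U_nonneg[OF that] c(1) by (simp add: \<kappa>_def)
  qed
  have "size_function Om \<kappa>"
    unfolding size_function_def
  proof (intro conjI allI impI)
    have "continuous_on Om (\<lambda>x. \<omega> (U x))"
      by (rule continuous_on_compose2[OF \<omega>(1) continuous_U]) simp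
    moreover have "\<omega> r \<noteq> 0" for r using \<omega>(3)[of r] by simp
    ultimately show cont: "continuous_on Om \<kappa>"
      unfolding \<kappa>_def using c(1) by (intro continuous_intros continuous_U) auto
    show "\<kappa> \<in> Om \<rightarrow> {0..}"
      using U_nonneg c(1) by (auto simp: \<kappa>_def)
    fix r
    define K where "K = {x \<in> Om. U x \<le> c * r\<^sup>2}"
    have K: "compact K" "K \<subseteq> Om" unfolding K_def by (auto intro: compact_sublevel)
    have "x \<in> K" if "x \<in> Om" "\<kappa> x \<le> r" for x
    proof -
      have "0 \<le> \<kappa> x" using U_nonneg[OF that(1)] c(1) by (simp add: \<kappa>_def)
      then have "c * (\<kappa> x)\<^sup>2 \<le> c * r\<^sup>2"
        using that(2) c(1) by (intro mult_left_mono power_mono) auto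
      then show ?thesis using \<kappa>_lower[OF that(1)] that(1) by (simp add: K_def)
    qed
    then have "{x \<in> Om. \<kappa> x \<le> r} = K \<inter> {x \<in> K. \<kappa> x \<le> r}" using K(2) by auto
    moreover have "closed {x \<in> K. \<kappa> x \<le> r}"
      using K by (intro continuous_on_closed_Collect_le continuous_on_const continuous_on_subset[OF cont] compact_imp_closed)
    ultimately show "compact {x \<in> Om. \<kappa> x \<le> r}" using compact_Int_closed[OF K(1)] by simp
  qed
  moreover have "\<kappa> eqm = 0" by (simp add: \<kappa>_def U_equilibrium)
  moreover have "state_dist n (x t) eqm \<le> exp (- (\<omega> 1 / 2) * t) * \<kappa> (x 0)"
    if x: "maximal_ring_solution n R L vmax vstar \<mu> V b J x" and t: "0 \<le> t" for J x t
  proof (rule power2_le_imp_le)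
    note s = global(2)[OF x]
    have "c * (state_dist n (x t) eqm)\<^sup>2 \<le> U (x t)" by (rule c(2)[OF Om[OF s t]])
    also have "\<dots> \<le> U (x 0) * exp (\<omega> 1 * U (x 0) / \<omega> (U (x 0))) * exp (- \<omega> 1 * t)"
      by (rule exponential_stability[OF \<omega> rate s t])
    also have "\<dots> = c * ((\<kappa> (x 0))\<^sup>2 * exp (- \<omega> 1 * t))"
      using U_nonneg[OF Om[OF s, of 0]] c(1) by (simp add: \<kappa>_def)
    also have "exp (- \<omega> 1 * t) = (exp (- (\<omega> 1 / 2) * t))\<^sup>2"
      by (simp add: power2_eq_square flip: exp_add)
    finally show "(state_dist n (x t) eqm)\<^sup>2 \<le> (exp (- (\<omega> 1 / 2) * t) * \<kappa> (x 0))\<^sup>2"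
      using c(1) by (simp add: power_mult_distrib mult.commute)
    show "0 \<le> exp (- (\<omega> 1 / 2) * t) * \<kappa> (x 0)"
      using U_nonneg[OF Om[OF s, of 0]] c(1) by (simp add: \<kappa>_def)
  qed
  moreover have "0 < \<omega> 1 / 2" using \<omega>(3) by simp
  ultimately have part2: "\<exists>\<kappa> \<omega>. size_function Om \<kappa> \<and> \<kappa> eqm = 0 \<and> \<omega> > 0 \<and>
        (\<forall>J x. maximal_ring_solution n R L vmax vstar \<mu> V b J x \<longrightarrow>
           (\<forall>t\<ge>0. state_dist n (x t) eqm \<le> exp (- \<omega> * t) * \<kappa> (x 0)))"
    by blast
  have part1: "\<forall>J x. maximal_ring_solution n R L vmax vstar \<mu> V b J x \<longrightarrow>
      J = {0..} \<and> (\<forall>t\<ge>0. c * (state_dist n (x t) eqm)\<^sup>2 \<le> U (x t) \<and>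
        U (x t) \<le> U (x 0) * exp (- \<omega> (U (x 0)) * t))"
    using global c(2) Om decay by blast
  show ?thesis
    by (intro conjI exI[of _ "\<lambda>s t. s * exp (- \<omega> s * t)"] exI[of _ "\<lambda>d. c * d\<^sup>2"] part2
        class_KL_exponential[OF \<omega>] class_K_inf_square[OF c(1)] part1)
qed

end

theorem theorem3:
  fixes n :: nat and R L lam vmax vstar \<mu> :: real and V b :: "real \<Rightarrow> real"
  assumes "n \<ge> 2" and "R > 0" and "0 < L" and "L < R / real n" and "lam > L"
    and "vmax > 0" and "0 < vstar" and "vstar < vmax" and "\<mu> > 0"
    and V_C3: "C_diff_on 3 V {L<..}"
    and V_nonneg: "\<And>x. x > L \<Longrightarrow> V x \<ge> 0"
    and V_lim: "filterlim V at_top (at_right L)"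
    and V_zero: "\<And>x. x \<ge> lam \<Longrightarrow> V x = 0"
    and V_deriv: "\<And>x. L < x \<Longrightarrow> x < lam \<Longrightarrow> deriv V x < 0"
    and V_deriv2: "\<And>x. L < x \<Longrightarrow> x < lam \<Longrightarrow> deriv (deriv V) x > 0"
    and b_C2: "C_diff_on 2 b UNIV"
    and b_range: "\<And>x. vstar - vmax < b x \<and> b x < vstar"
    and b_mono: "strict_mono b"
    and b_0: "b 0 = 0"
    and b_sgn: "\<And>x. x \<noteq> 0 \<Longrightarrow> x * b x > 0"
    and b_deriv: "deriv b 0 > 0"
    and R_less: "R < real n * lam"
  shows
    "(\<exists>\<sigma> a. class_KL \<sigma> \<and> class_K_inf a \<and>
        (\<forall>J x. maximal_ring_solution n R L vmax vstar \<mu> V b J x \<longrightarrow>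
           J = {0..} \<and>
           (\<forall>t\<ge>0. a (state_dist n (x t) (equilibrium n R vstar)) \<le> U_ring n R vmax vstar V b (x t) \<and>
                  U_ring n R vmax vstar V b (x t) \<le> \<sigma> (U_ring n R vmax vstar V b (x 0)) t))) \<and>
     (\<exists>\<kappa> \<omega>. size_function (Omega n R L vmax) \<kappa> \<and> \<kappa> (equilibrium n R vstar) = 0 \<and> \<omega> > 0 \<and>
        (\<forall>J x. maximal_ring_solution n R L vmax vstar \<mu> V b J x \<longrightarrow>
           (\<forall>t\<ge>0. state_dist n (x t) (equilibrium n R vstar) \<le> exp (- \<omega> * t) * \<kappa> (x 0))))"
proof -
  interpret ring_road n R L lam vmax vstar \<mu> V b
    by unfold_locales (fact assms)+
  show ?thesis by (rule stability)
qed

end
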